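(* Let $H$ be a complex separable Hilbert space, let $A$ and $B$ be compact operators on $H$, and let $0\leq\alpha\leq 1$. Then $$s_{j}(A+B)\leq s_{j}\left(\left(|A|^{2\alpha}+|B|^{2\alpha}\right)\oplus\left(|A^{*}|^{2(1-\alpha)}+|B^{*}|^{2(1-\alpha)}\right)\right)$$ for all $j=1,2,\ldots$.
   Context: For a bounded operator $T$, $|T|=(T^{*}T)^{1/2}$. Powers of positive operators are taken by continuous functional calculus, with $t^{0}\equiv 1$ (so $|T|^{0}=I$). For bounded operators $S,T$ on $H$, $S\oplus T$ denotes the block diagonal operator $\begin{bmatrix} S&0\\0&T\end{bmatrix}$ on $H\oplus H$. For a compact operator $T$, $s_{1}(T)\geq s_{2}(T)\geq\cdots$ are the singular values of $T$, i.e. the eigenvalues of $|T|$ in decreasing order repeated according to multiplicity (extended by zeros if necessary). For a bounded operator $T$ that need not be compact (relevant here only when $\alpha\in\{0,1\}$), $s_{j}(T)=\inf\{\|T-F\|: F \text{ bounded},\ \operatorname{rank}F<j\}$, which agrees with the preceding definition when $T$ is compact. *)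

theory Defs
  imports "HOL-Analysis.Analysis" "HOL-Computational_Algebra.Polynomial"
begin

class complex_vector = real_vector +
  fixes scaleC :: "complex \<Rightarrow> 'a \<Rightarrow> 'a" (infixr "*\<^sub>C" 75)
  assumes scaleC_add_right: "c *\<^sub>C (x + y) = c *\<^sub>C x + c *\<^sub>C y"
    and scaleC_add_left: "(c + d) *\<^sub>C x = c *\<^sub>C x + d *\<^sub>C x"
    and scaleC_scaleC: "c *\<^sub>C d *\<^sub>C x = (c * d) *\<^sub>C x"
    and scaleC_one: "1 *\<^sub>C x = x"
    and scaleC_of_real: "complex_of_real r *\<^sub>C x = r *\<^sub>R x"

text \<open>
  The real structure of a complex inner product space is inherited: the real inner product is
  the real part of the complex one, so \<open>norm x = sqrt (Re (cinner x x))\<close> and positive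
  definiteness come from \<^class>\<open>real_inner\<close>.  The form \<open>cinner\<close> is linear in its first argument.
\<close>

class complex_inner = complex_vector + real_inner +
  fixes cinner :: "'a \<Rightarrow> 'a \<Rightarrow> complex"
  assumes cinner_commute: "cinner x y = cnj (cinner y x)"
    and cinner_add_left: "cinner (x + y) z = cinner x z + cinner y z"
    and cinner_scaleC_left: "cinner (c *\<^sub>C x) y = c * cinner x y"
    and Re_cinner: "Re (cinner x y) = x \<bullet> y"

class chilbert_space = complex_inner + complete_space

instantiation prod :: (complex_vector, complex_vector) complex_vector
begin

definition "c *\<^sub>C p = (c *\<^sub>C fst p, c *\<^sub>C snd p)"

instance
  by standard
    (auto simp: scaleC_prod_def scaleC_add_right scaleC_add_left scaleC_scaleC scaleC_one
      scaleC_of_real prod_eq_iff)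

end

instantiation prod :: (complex_inner, complex_inner) complex_inner
begin

definition "cinner p q = cinner (fst p) (fst q) + cinner (snd p) (snd q)"

instance
proof
  fix p q r :: "'a \<times> 'b" and c :: complex
  show "cinner p q = cnj (cinner q p)"
    unfolding cinner_prod_def complex_cnj_add by (metis cinner_commute)
  show "cinner (p + q) r = cinner p r + cinner q r"
    by (simp add: cinner_prod_def cinner_add_left)
  show "cinner (c *\<^sub>C p) q = c * cinner p q"
    by (simp add: cinner_prod_def scaleC_prod_def cinner_scaleC_left algebra_simps)
  show "Re (cinner p q) = p \<bullet> q"
    by (simp add: cinner_prod_def inner_prod_def Re_cinner)
qed

end

instance prod :: (chilbert_space, chilbert_space) chilbert_space ..

global_interpretation complex_vector:
  vector_space "scaleC :: complex \<Rightarrow> 'a \<Rightarrow> 'a::complex_vector"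
  defines cspan = complex_vector.span
    and cdim = complex_vector.dim
  by standard (simp_all add: scaleC_add_right scaleC_add_left scaleC_scaleC scaleC_one)

definition bounded_clinear :: "('a::complex_inner \<Rightarrow> 'b::complex_inner) \<Rightarrow> bool" where
  "bounded_clinear T \<longleftrightarrow> bounded_linear T \<and> (\<forall>c x. T (c *\<^sub>C x) = c *\<^sub>C T x)"

definition compact_op :: "('a::complex_inner \<Rightarrow> 'b::complex_inner) \<Rightarrow> bool" where
  "compact_op T \<longleftrightarrow> bounded_clinear T \<and> compact (closure (T ` cball 0 1))"

definition cadjoint :: "('a::complex_inner \<Rightarrow> 'b::complex_inner) \<Rightarrow> 'b \<Rightarrow> 'a" where
  "cadjoint T = (THE S. \<forall>x y. cinner (T x) y = cinner x (S y))"

text \<open>On \<open>H \<oplus> H\<close>, realised as the product type, this is the block diagonal operator.\<close>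

abbreviation op_dsum :: "('a \<Rightarrow> 'c) \<Rightarrow> ('b \<Rightarrow> 'd) \<Rightarrow> 'a \<times> 'b \<Rightarrow> 'c \<times> 'd" where
  "op_dsum S T \<equiv> map_prod S T"

definition op_spectrum :: "('a::complex_inner \<Rightarrow> 'a) \<Rightarrow> complex set" where
  "op_spectrum T =
    {z. \<not> (\<exists>S. bounded_clinear S \<and> (\<forall>x. S (T x - z *\<^sub>C x) = x) \<and> (\<forall>x. T (S x) - z *\<^sub>C S x = x))}"

definition poly_op :: "real poly \<Rightarrow> ('a::complex_inner \<Rightarrow> 'a) \<Rightarrow> 'a \<Rightarrow> 'a" where
  "poly_op p T = (\<lambda>x. \<Sum>i\<le>degree p. coeff p i *\<^sub>R (T ^^ i) x)"

text \<open>
  Continuous functional calculus \<open>f(T)\<close> of a bounded self-adjoint operator \<open>T\<close>, for a real function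
  \<open>f\<close> continuous on the (then real) spectrum of \<open>T\<close>: the norm limit of \<open>p n (T)\<close> for every sequence
  of polynomials \<open>p n\<close> converging to \<open>f\<close> uniformly on the spectrum.
\<close>

definition cont_fun_calc :: "(real \<Rightarrow> real) \<Rightarrow> ('a::complex_inner \<Rightarrow> 'a) \<Rightarrow> 'a \<Rightarrow> 'a" where
  "cont_fun_calc f T = (THE Q. bounded_clinear Q \<and>
    (\<forall>p. uniform_limit {t. complex_of_real t \<in> op_spectrum T} (\<lambda>n t. poly (p n) t) f sequentially
      \<longrightarrow> (\<lambda>n. onorm (\<lambda>x. poly_op (p n) T x - Q x)) \<longlonglongrightarrow> 0))"

text \<open>The convention \<open>t\<^sup>0 = 1\<close> has to be imposed at \<open>t = 0\<close>, as \<open>0 powr 0 = 0\<close>.\<close>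

definition op_powr :: "('a::complex_inner \<Rightarrow> 'a) \<Rightarrow> real \<Rightarrow> 'a \<Rightarrow> 'a" where
  "op_powr P r = cont_fun_calc (\<lambda>t. if r = 0 then 1 else t powr r) P"

definition op_abs :: "('a::complex_inner \<Rightarrow> 'b::complex_inner) \<Rightarrow> 'a \<Rightarrow> 'a" where
  "op_abs T = op_powr (cadjoint T \<circ> T) (1 / 2)"

text \<open>
  The eigenvalues of a compact positive operator \<open>P\<close> in decreasing order, starting at index \<open>0\<close>:
  every \<open>c > 0\<close> occurs exactly as often as its multiplicity \<open>dim ker (P - c)\<close> says (not at all if it
  is not an eigenvalue), and all remaining entries are \<open>0\<close>.
\<close>

definition eigenvalue_seq :: "('a::complex_inner \<Rightarrow> 'a) \<Rightarrow> nat \<Rightarrow> real" where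
  "eigenvalue_seq P = (THE s. decseq s \<and> (\<forall>n. 0 \<le> s n) \<and>
    (\<forall>c>0. finite {n. s n = c} \<and> card {n. s n = c} = cdim {x. P x = complex_of_real c *\<^sub>C x}))"

text \<open>
  As \<^const>\<open>cdim\<close> is \<open>0\<close> on infinite-dimensional subspaces, finite dimension is required separately.
\<close>

definition rank_less :: "('a::complex_inner \<Rightarrow> 'b::complex_inner) \<Rightarrow> nat \<Rightarrow> bool" where
  "rank_less F j \<longleftrightarrow> (\<exists>S. finite S \<and> range F \<subseteq> cspan S) \<and> cdim (range F) < j"

text \<open>The index \<open>j\<close> of a singular value starts at \<open>1\<close>.\<close>

definition singular_value :: "nat \<Rightarrow> ('a::complex_inner \<Rightarrow> 'a) \<Rightarrow> real" where
  "singular_value j T =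
    (if compact_op T then eigenvalue_seq (op_abs T) (j - 1)
     else Inf {onorm (\<lambda>x. T x - F x) | F. bounded_clinear F \<and> rank_less F j})"

end

theory Submission
  imports Defs
begin

text \<open>
  Write \<open>P = |A|\<^bsup>2\<alpha>\<^esup> + |B|\<^bsup>2\<alpha>\<^esup>\<close>, \<open>Q = |A\<^sup>*|\<^bsup>2(1 - \<alpha>)\<^esup> + |B\<^sup>*|\<^bsup>2(1 - \<alpha>)\<^esup>\<close> and \<open>X = A + B\<close>.
  The singular value expansion of \<open>A\<close> and the arithmetic-geometric mean inequality give Kato's mixed
  Schwarz inequality \<open>2 Re \<langle>A y, x\<rangle> \<le> \<langle>|A|\<^bsup>2\<alpha>\<^esup> y, y\<rangle> + \<langle>|A\<^sup>*|\<^bsup>2(1 - \<alpha>)\<^esup> x, x\<rangle>\<close>, and likewise for \<open>B\<close>. Adding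
  the two, the quadratic form of \<open>P \<oplus> Q\<close> at \<open>(y, x)\<close> dominates \<open>2 Re \<langle>X y, x\<rangle>\<close>. If \<open>v\<^sub>1, \<dots>, v\<^sub>j\<close> are
  orthonormal eigenvectors of \<open>|X|\<close> with eigenvalues \<open>s\<^sub>i \<ge> s\<^sub>j(X)\<close>, then on the \<open>j\<close>-dimensional span of
  the pairs \<open>(v\<^sub>i, X v\<^sub>i / s\<^sub>i)\<close> this form is at least \<open>s\<^sub>j(X) \<parallel>w\<parallel>\<^sup>2\<close>. Every operator of rank less than \<open>j\<close>
  annihilates a nonzero vector of that span, hence \<open>s\<^sub>j(X) \<le> s\<^sub>j(P \<oplus> Q)\<close>.
\<close>

section \<open>Complex inner products and orthonormal families\<close>

\<comment> \<open>The pairs are eigenvectors of the self-adjoint operator (y, x) -> (X^* x, X y),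
  whose quadratic form is 2 Re <X y, x>. A pair has squared norm 2, and this 2 cancels the factor 2
  in the mixed Schwarz inequality. For \<alpha> = 0 or 1 the direct sum contains twice the identity
  and is not compact in infinite dimensions, so \<open>singular_value\<close> may fall into either
  of its two branches. This is why the comparison is made against an arbitrary operator of rank less
  than j: it becomes a spectral projection of the modulus in the compact branch and a near-optimal
  approximant in the other. \<open>cadjoint\<close>, \<open>cont_fun_calc\<close> and
  \<open>eigenvalue_seq\<close> are definite descriptions, so existence and uniqueness come first
  for each. No full spectral decomposition is set up. A finite eigenbasis above a threshold t > 0,
  with the operator bounded by t on the orthogonal complement, carries the norm estimates, the
  eigenvalue counts and the singular value expansion.\<close>
subclass (in chilbert_space) banach ..

lemma cinner_scaleR_left: "cinner (r *\<^sub>R x) y = of_real r * cinner x y"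
  by (metis cinner_scaleC_left scaleC_of_real)

lemma cinner_add_right: "cinner x (y + z) = cinner x y + cinner x z"
  by (metis cinner_add_left cinner_commute complex_cnj_add)

lemma cinner_scaleC_right: "cinner x (c *\<^sub>C y) = cnj c * cinner x y"
  by (metis cinner_scaleC_left cinner_commute complex_cnj_mult)

lemma cinner_zero_left [simp]: "cinner 0 y = 0"
  using cinner_scaleR_left[of 0 0 y] by simp

lemma cinner_zero_right [simp]: "cinner x 0 = 0"
  by (metis cinner_commute cinner_zero_left complex_cnj_zero)

lemma cinner_diff_left: "cinner (x - y) z = cinner x z - cinner y z"
  using cinner_add_left[of "x - y" y z] by simp

lemma cinner_sum_left: "cinner (\<Sum>i\<in>I. f i) y = (\<Sum>i\<in>I. cinner (f i) y)"
  by (induction I rule: infinite_finite_induct) (auto simp: cinner_add_left)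

lemma cinner_sum_right: "cinner x (\<Sum>i\<in>I. f i) = (\<Sum>i\<in>I. cinner x (f i))"
  by (induction I rule: infinite_finite_induct) (auto simp: cinner_add_right)

lemma Im_cinner: "Im (cinner x y) = - ((\<i> *\<^sub>C x) \<bullet> y)"
  by (simp add: cinner_scaleC_left flip: Re_cinner)

lemma cinner_self: "cinner x x = of_real ((norm x)\<^sup>2)"
proof -
  have "Im (cinner x x) = 0"
    using cinner_commute[of x x] by (simp add: complex_eq_iff)
  then show ?thesis
    by (simp add: complex_eq_iff Re_cinner power2_norm_eq_inner)
qed

lemma norm_cinner_commute: "cmod (cinner x y) = cmod (cinner y x)"
  by (metis cinner_commute complex_mod_cnj)

lemma norm_scaleC: "norm (c *\<^sub>C x) = cmod c * norm x" for x :: "'a::complex_inner"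
proof -
  have "complex_of_real ((norm (c *\<^sub>C x))\<^sup>2) = cinner (c *\<^sub>C x) (c *\<^sub>C x)"
    by (rule cinner_self[symmetric])
  also have "\<dots> = (c * cnj c) * cinner x x"
    by (simp only: cinner_scaleC_left cinner_scaleC_right mult_ac)
  also have "\<dots> = of_real ((cmod c * norm x)\<^sup>2)"
    by (simp add: cinner_self power_mult_distrib flip: complex_norm_square)
  finally have "complex_of_real ((norm (c *\<^sub>C x))\<^sup>2) = of_real ((cmod c * norm x)\<^sup>2)" .
  then have "(norm (c *\<^sub>C x))\<^sup>2 = (cmod c * norm x)\<^sup>2"
    using of_real_eq_iff by blast
  then show ?thesis
    by (simp add: power2_eq_iff_nonneg)
qed

lemma bounded_linear_scaleC_right: "bounded_linear (\<lambda>x::'a::complex_inner. c *\<^sub>C x)"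
proof (rule bounded_linear_intro)
  show "c *\<^sub>C r *\<^sub>R x = r *\<^sub>R c *\<^sub>C x" for r and x :: 'a
    by (simp add: scaleC_scaleC mult.commute flip: scaleC_of_real)
  show "norm (c *\<^sub>C x) \<le> norm x * cmod c" for x :: 'a
    by (simp add: norm_scaleC)
qed (rule scaleC_add_right)

lemma bounded_clinearD:
  assumes "bounded_clinear T"
  shows "bounded_linear T" "T (c *\<^sub>C x) = c *\<^sub>C T x" "T (x + y) = T x + T y"
    "T (x - y) = T x - T y" "T (r *\<^sub>R x) = r *\<^sub>R T x" "T 0 = 0"
    "T (\<Sum>i\<in>I. f i) = (\<Sum>i\<in>I. T (f i))"
proof -
  show 1: "bounded_linear T" and "T (c *\<^sub>C x) = c *\<^sub>C T x"
    using assms by (auto simp: bounded_clinear_def)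
  then interpret bounded_linear T by simp
  show "T (x + y) = T x + T y" "T (x - y) = T x - T y" "T (r *\<^sub>R x) = r *\<^sub>R T x" "T 0 = 0"
    "T (\<Sum>i\<in>I. f i) = (\<Sum>i\<in>I. T (f i))"
    by (simp_all add: add diff scaleR sum)
qed

text \<open>Complex linearity recovers the imaginary part from the real one by replacing
  \<open>x\<close> with \<open>\<i> *\<^sub>C x\<close>, so adjoint relations need checking only for
  the real inner product.\<close>

lemma cinner_adjointI:
  assumes "bounded_clinear T" "\<And>x y. T x \<bullet> y = x \<bullet> S y"
  shows "cinner (T x) y = cinner x (S y)"
  by (simp add: complex_eq_iff Re_cinner Im_cinner assms flip: bounded_clinearD(2))

text \<open>A family rather than a set of vectors: eigenvectors enter as the identity family, and
  the left singular vectors as a family over the same index set.\<close>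

definition corthonormal :: "('i \<Rightarrow> 'a::complex_inner) \<Rightarrow> 'i set \<Rightarrow> bool" where
  "corthonormal f I \<longleftrightarrow> (\<forall>i\<in>I. \<forall>k\<in>I. cinner (f i) (f k) = (if i = k then 1 else 0))"

lemma cinner_sum_corthonormal:
  assumes "finite I" "corthonormal f I" "k \<in> I"
  shows "cinner (\<Sum>i\<in>I. a i *\<^sub>C f i) (f k) = a k"
proof -
  have "cinner (\<Sum>i\<in>I. a i *\<^sub>C f i) (f k) = (\<Sum>i\<in>I. a i * (if i = k then 1 else 0))"
    unfolding cinner_sum_left cinner_scaleC_left
    using assms by (intro sum.cong) (auto simp: corthonormal_def)
  also have "\<dots> = (\<Sum>i\<in>I. if i = k then a i else 0)"
    by (intro sum.cong) auto
  finally show ?thesis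
    using assms by simp
qed

lemma cinner_sum_sum_corthonormal:
  assumes "finite I" "corthonormal f I"
  shows "cinner (\<Sum>i\<in>I. a i *\<^sub>C f i) (\<Sum>i\<in>I. b i *\<^sub>C f i) = (\<Sum>i\<in>I. a i * cnj (b i))"
proof -
  have "cinner (\<Sum>i\<in>I. a i *\<^sub>C f i) (\<Sum>i\<in>I. b i *\<^sub>C f i)
      = (\<Sum>k\<in>I. cnj (b k) * cinner (\<Sum>i\<in>I. a i *\<^sub>C f i) (f k))"
    by (simp add: cinner_sum_right cinner_scaleC_right)
  also have "\<dots> = (\<Sum>k\<in>I. cnj (b k) * a k)"
    using assms by (intro sum.cong) (auto simp: cinner_sum_corthonormal)
  finally show ?thesis
    by (simp add: mult.commute)
qed

lemma norm_sum_corthonormal: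
  assumes "finite I" "corthonormal f I"
  shows "(norm (\<Sum>i\<in>I. a i *\<^sub>C f i))\<^sup>2 = (\<Sum>i\<in>I. (cmod (a i))\<^sup>2)"
proof -
  have "complex_of_real ((norm (\<Sum>i\<in>I. a i *\<^sub>C f i))\<^sup>2) = of_real (\<Sum>i\<in>I. (cmod (a i))\<^sup>2)"
    unfolding cinner_self[symmetric] cinner_sum_sum_corthonormal[OF assms]
    by (simp add: complex_norm_square flip: of_real_power)
  then show ?thesis
    using of_real_eq_iff by blast
qed

lemma corthonormal_residual:
  assumes "finite I" "corthonormal f I" "k \<in> I"
  shows "cinner (x - (\<Sum>i\<in>I. cinner x (f i) *\<^sub>C f i)) (f k) = 0"
  by (simp add: cinner_diff_left cinner_sum_corthonormal[OF assms])

lemma cinner_sum_residual: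
  assumes "finite I" "corthonormal f I"
  shows "cinner (\<Sum>i\<in>I. a i *\<^sub>C f i) (x - (\<Sum>i\<in>I. cinner x (f i) *\<^sub>C f i)) = 0"
proof -
  have "cinner (f k) (x - (\<Sum>i\<in>I. cinner x (f i) *\<^sub>C f i)) = 0" if "k \<in> I" for k
    using corthonormal_residual[OF assms that] by (metis cinner_commute complex_cnj_zero)
  then show ?thesis
    by (simp add: cinner_sum_left cinner_scaleC_left)
qed

section \<open>The Riesz lemma and adjoints\<close>

text \<open>For \<open>S = id\<close> this is the Riesz representation theorem; for a self-adjoint \<open>S\<close> that is bounded
  below it shows that \<open>S \<circ> S\<close> is onto. The solution minimises \<open>\<parallel>S x\<parallel>\<^sup>2 - 2 f x\<close>.\<close>

lemma coercive_representation:
  fixes S :: "'a::{real_inner,complete_space} \<Rightarrow> 'b::real_inner" and f :: "'a \<Rightarrow> real"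
  assumes S: "bounded_linear S" and f: "bounded_linear f"
    and \<delta>: "\<delta> > 0" "\<And>x. \<delta> * norm x \<le> norm (S x)"
  shows "\<exists>x. \<forall>z. S x \<bullet> S z = f z"
proof -
  interpret S: bounded_linear S by fact
  interpret f: bounded_linear f by fact
  obtain K where K: "\<And>x. norm (f x) \<le> norm x * K"
    using f.bounded by blast
  define \<phi> where "\<phi> x = (norm (S x))\<^sup>2 - 2 * f x" for x
  \<comment> \<open>Completing the square: \<open>\<phi> x\<close> is at least \<delta>^2 u^2 - 2 K
    u with u = |x|, whose minimum over real u is this constant.\<close>
  have below: "- (K / \<delta>)\<^sup>2 \<le> \<phi> x" for x
  proof -
    have "(\<delta> * norm x)\<^sup>2 \<le> (norm (S x))\<^sup>2"
      using \<delta> by (intro power_mono) auto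
    moreover have "f x \<le> norm x * K"
      using K[of x] by simp
    moreover have "0 \<le> (\<delta> * norm x - K / \<delta>)\<^sup>2"
      by simp
    ultimately show ?thesis
      using \<delta>(1) unfolding \<phi>_def power2_diff by (auto simp: power2_eq_square)
  qed
  define m where "m = Inf (range \<phi>)"
  have bdd: "bdd_below (range \<phi>)"
    using below by (intro bdd_belowI2)
  have m_le: "m \<le> \<phi> x" for x
    unfolding m_def using bdd by (intro cInf_lower) auto
  have "\<exists>x. \<phi> x < m + inverse (real (Suc n))" for n
    using cInf_lessD[of "range \<phi>" "m + inverse (real (Suc n))"] unfolding m_def by auto
  then obtain x where x: "\<And>n. \<phi> (x n) < m + inverse (real (Suc n))"
    by metis
  \<comment> \<open>Parallelogram law: the linear parts cancel at the midpoint, so near-minimisers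
    are close together and a minimising sequence is Cauchy.\<close>
  have par: "(\<delta> * norm (a - b))\<^sup>2 \<le> 2 * (\<phi> a - m) + 2 * (\<phi> b - m)" for a b
  proof -
    have "(\<delta> * norm (a - b))\<^sup>2 \<le> (norm (S (a - b)))\<^sup>2"
      using \<delta> by (intro power_mono) auto
    also have "\<dots> = 2 * \<phi> a + 2 * \<phi> b - 4 * \<phi> ((1/2) *\<^sub>R (a + b))"
      unfolding \<phi>_def S.scaleR S.add S.diff f.scaleR f.add power2_norm_eq_inner
      by (simp add: algebra_simps inner_commute)
    finally show ?thesis
      using m_le[of "(1/2) *\<^sub>R (a + b)"] by simp
  qed
  have "Cauchy x"
  proof (rule metric_CauchyI)
    fix e :: real assume "e > 0"
    then have "(\<delta> * e)\<^sup>2 / 4 > 0"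
      using \<delta>(1) by simp
    then obtain N where N: "inverse (real (Suc N)) < (\<delta> * e)\<^sup>2 / 4"
      using reals_Archimedean by blast
    have *: "\<phi> (x k) - m < (\<delta> * e)\<^sup>2 / 4" if "k \<ge> N" for k
    proof -
      have "inverse (real (Suc k)) \<le> inverse (real (Suc N))"
        using that by (intro le_imp_inverse_le) auto
      then show ?thesis
        using x[of k] N by linarith
    qed
    have "dist (x k) (x l) < e" if "k \<ge> N" "l \<ge> N" for k l
    proof -
      have "(\<delta> * norm (x k - x l))\<^sup>2 < (\<delta> * e)\<^sup>2"
        using order.strict_trans1[OF par[of "x k" "x l"], of "(\<delta> * e)\<^sup>2"]
          *[OF that(1)] *[OF that(2)] by (simp add: field_simps)
      then have "\<delta> * norm (x k - x l) < \<delta> * e"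
        using \<delta>(1) \<open>e > 0\<close> by (intro power2_less_imp_less[of _ "\<delta> * e"]) auto
      then show ?thesis
        using \<delta>(1) by (simp add: dist_norm)
    qed
    then show "\<exists>N. \<forall>k\<ge>N. \<forall>l\<ge>N. dist (x k) (x l) < e"
      by blast
  qed
  then obtain y where y: "x \<longlonglongrightarrow> y"
    using Cauchy_convergent convergent_def by blast
  have "(\<lambda>n. \<phi> (x n)) \<longlonglongrightarrow> \<phi> y"
    unfolding \<phi>_def by (intro tendsto_intros S.tendsto f.tendsto y)
  moreover have "(\<lambda>n. m + inverse (real (Suc n))) \<longlonglongrightarrow> m + 0"
    by (intro tendsto_intros LIMSEQ_inverse_real_of_nat)
  ultimately have y_le: "\<phi> y \<le> m"
    using x by (intro LIMSEQ_le[of "\<lambda>n. \<phi> (x n)" _ "\<lambda>n. m + inverse (real (Suc n))"])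
      (auto intro: less_imp_le)
  have "S y \<bullet> S z = f z" for z
  proof -
    define a b where "a = (norm (S z))\<^sup>2" and "b = S y \<bullet> S z - f z"
    have a: "a \<ge> 0"
      by (simp add: a_def)
    \<comment> \<open>Step length of a variation of the minimiser in direction \<open>- z\<close>.
      It changes \<phi> by -s^2 (a + 2), which minimality forces to be nonnegative; the 1 keeps the
      denominator positive when \<open>S z\<close> is 0.\<close>
    define s where "s = b / (a + 1)"
    have b: "b = s * (a + 1)"
      using a by (simp add: s_def)
    have "\<phi> (y + (- s) *\<^sub>R z) = \<phi> y + (s\<^sup>2 * a - 2 * s * b)"
      unfolding \<phi>_def S.scaleR S.add f.scaleR f.add a_def b_def power2_norm_eq_inner
      by (simp add: algebra_simps inner_commute power2_eq_square)
    then have "0 \<le> s\<^sup>2 * a - 2 * s * b"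
      using m_le[of "y + (- s) *\<^sub>R z"] y_le by linarith
    also have "\<dots> = - (s\<^sup>2 * (a + 2))"
      by (simp add: b algebra_simps power2_eq_square)
    finally have "s = 0"
      using a by (simp add: mult_le_0_iff)
    then show ?thesis
      using b by (simp add: b_def)
  qed
  then show ?thesis
    by blast
qed

section \<open>Adjoints of bounded operators\<close>

lemma cinner_ext:
  assumes "\<And>x. cinner x y = cinner x z"
  shows "y = z"
proof -
  have "x \<bullet> y = x \<bullet> z" for x
    using assms by (metis Re_cinner)
  then show ?thesis
    by (metis vector_eq_rdot inner_commute)
qed

text \<open>Riesz, the case S = id of the minimisation above, yields an adjoint for the real inner
  product; \<open>cinner_adjointI\<close> makes it complex, and \<open>cinner_ext\<close> gives the
  uniqueness that the description in \<open>cadjoint\<close> requires.\<close>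

lemma cadjoint_works:
  fixes T :: "'a::chilbert_space \<Rightarrow> 'b::complex_inner"
  assumes T: "bounded_clinear T"
  shows "cinner (T x) y = cinner x (cadjoint T y)"
proof -
  have "\<exists>S. \<forall>x y. cinner (T x) y = cinner x (S y)"
  proof -
    have "\<exists>z. \<forall>x. id z \<bullet> id x = T x \<bullet> y" for y
      using bounded_linear_compose[OF bounded_linear_inner_left bounded_clinearD(1)[OF T], of y]
      by (intro coercive_representation[where \<delta> = 1]) (auto simp: id_def)
    then obtain S where "\<And>x y. S y \<bullet> x = T x \<bullet> y"
      by (metis id_apply)
    then show ?thesis
      using cinner_adjointI[OF T, of S] by (metis inner_commute)
  qed
  moreover have "S = S'" if "\<forall>x y. cinner (T x) y = cinner x (S y)"
    "\<forall>x y. cinner (T x) y = cinner x (S' y)" for S S'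
    using that by (metis cinner_ext ext)
  ultimately have "\<exists>!S. \<forall>x y. cinner (T x) y = cinner x (S y)"
    by blast
  from theI'[OF this] show ?thesis
    unfolding cadjoint_def by blast
qed

lemma inner_cadjoint:
  fixes T :: "'a::chilbert_space \<Rightarrow> 'b::complex_inner"
  assumes T: "bounded_clinear T"
  shows "T x \<bullet> y = x \<bullet> cadjoint T y"
  by (metis T Re_cinner cadjoint_works)

lemma bounded_clinear_cadjoint:
  fixes T :: "'a::chilbert_space \<Rightarrow> 'b::complex_inner"
  assumes T: "bounded_clinear T"
  shows "bounded_clinear (cadjoint T)"
proof -
  note T_adj = cadjoint_works[OF T]
  have add: "cadjoint T (x + y) = cadjoint T x + cadjoint T y" for x y
    by (rule cinner_ext) (simp add: cinner_add_right flip: T_adj)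
  have scaleC: "cadjoint T (c *\<^sub>C x) = c *\<^sub>C cadjoint T x" for c x
    by (rule cinner_ext) (simp add: cinner_scaleC_right flip: T_adj)
  have "\<exists>K. \<forall>x. norm (T x) \<le> norm x * K \<and> 0 \<le> K"
    using bounded_linear.nonneg_bounded[OF bounded_clinearD(1)[OF T]] by blast
  then obtain K where K: "\<And>x. norm (T x) \<le> norm x * K" "K \<ge> 0"
    by blast
  have bound: "norm (cadjoint T y) \<le> norm y * K" for y
  proof -
    let ?z = "cadjoint T y"
    have "norm ?z * norm ?z = T ?z \<bullet> y"
      by (simp add: inner_cadjoint[OF T] power2_norm_eq_inner flip: power2_eq_square)
    also have "\<dots> \<le> norm (T ?z) * norm y"
      by (rule norm_cauchy_schwarz)
    also have "\<dots> \<le> (norm ?z * K) * norm y"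
      by (intro mult_right_mono K) auto
    finally have "norm ?z * norm ?z \<le> norm ?z * (norm y * K)"
      by (simp add: mult_ac)
    then show ?thesis
      using K(2) by (cases "norm ?z = 0") (auto simp: mult_le_cancel_left)
  qed
  have "bounded_linear (cadjoint T)"
    by (rule bounded_linear_intro[OF add _ bound]) (metis scaleC scaleC_of_real)
  then show ?thesis
    using scaleC by (simp add: bounded_clinear_def)
qed

lemma cadjoint_cadjoint:
  fixes T :: "'a::chilbert_space \<Rightarrow> 'b::chilbert_space"
  assumes T: "bounded_clinear T"
  shows "cadjoint (cadjoint T) = T"
proof
  fix x
  show "cadjoint (cadjoint T) x = T x"
    by (rule cinner_ext)
      (metis T bounded_clinear_cadjoint cadjoint_works cinner_commute)
qed

section \<open>Compact positive operators\<close>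

text \<open>Compactness through subsequences passes easily through compositions with bounded
  operators and from T^* T to |T|.\<close>

definition seq_compact_op :: "('a::real_normed_vector \<Rightarrow> 'b::real_normed_vector) \<Rightarrow> bool" where
  "seq_compact_op T \<longleftrightarrow>
    (\<forall>x::nat \<Rightarrow> 'a. bounded (range x) \<longrightarrow> (\<exists>r. strict_mono r \<and> convergent (\<lambda>n. T (x (r n)))))"

lemma compact_op_imp_seq_compact_op:
  assumes "compact_op T"
  shows "seq_compact_op T"
  unfolding seq_compact_op_def
proof (intro allI impI)
  fix x :: "nat \<Rightarrow> 'a"
  assume "bounded (range x)"
  then obtain K where K: "K > 0" "\<And>n. norm (x n) \<le> K"
    by (auto simp: bounded_pos)
  have T: "bounded_clinear T" and c: "compact (closure (T ` cball 0 1))"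
    using assms by (auto simp: compact_op_def)
  define y where "y n = (1 / K) *\<^sub>R x n" for n
  have "T (y n) \<in> closure (T ` cball 0 1)" for n
    using K closure_subset by (force simp: y_def)
  then obtain l r where "strict_mono r" and lim: "((\<lambda>n. T (y n)) \<circ> r) \<longlonglongrightarrow> l"
    using compact_imp_seq_compact[OF c] by (force elim: seq_compactE)
  have "(\<lambda>n. K *\<^sub>R T (y (r n))) \<longlonglongrightarrow> K *\<^sub>R l"
    using lim by (intro tendsto_intros) (simp add: o_def)
  moreover have "K *\<^sub>R T (y n) = T (x n)" for n
    using K by (simp add: y_def bounded_clinearD[OF T])
  ultimately show "\<exists>r. strict_mono r \<and> convergent (\<lambda>n. T (x (r n)))"
    using \<open>strict_mono r\<close> by (auto simp: convergent_def)
qed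

lemma bounded_clinear_add:
  assumes "bounded_clinear S" "bounded_clinear T"
  shows "bounded_clinear (\<lambda>x. S x + T x)"
  using assms by (auto simp: bounded_clinear_def scaleC_add_right intro: bounded_linear_add)

lemma bounded_clinear_compose:
  assumes "bounded_clinear S" "bounded_clinear T"
  shows "bounded_clinear (\<lambda>x. S (T x))"
  using assms by (auto simp: bounded_clinear_def intro: bounded_linear_compose)

text \<open>Proved for \<open>compact_op\<close> itself and not only for the sequential form,
  because \<open>singular_value\<close> of the sum branches on this predicate. The image of the ball
  lies in a sum of two compact sets.\<close>

lemma compact_op_add:
  assumes "compact_op S" "compact_op T"
  shows "compact_op (\<lambda>x. S x + T x)"
proof -
  define K where "K = {a + b | a b. a \<in> closure (S ` cball 0 1) \<and> b \<in> closure (T ` cball 0 1)}"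
  have "compact K"
    using assms unfolding K_def compact_op_def by (intro compact_sums) auto
  moreover have "(\<lambda>x. S x + T x) ` cball 0 1 \<subseteq> K"
  proof clarify
    fix x :: 'a assume "x \<in> cball 0 1"
    then have "S x \<in> closure (S ` cball 0 1)" "T x \<in> closure (T ` cball 0 1)"
      by (meson closure_subset image_eqI subsetD)+
    then show "S x + T x \<in> K"
      unfolding K_def by blast
  qed
  ultimately have "closure ((\<lambda>x. S x + T x) ` cball 0 1) \<subseteq> K"
    by (intro closure_minimal compact_imp_closed)
  then have "compact (closure ((\<lambda>x. S x + T x) ` cball 0 1))"
    using compact_Int_closed[OF \<open>compact K\<close> closed_closure] by (metis inf.absorb2)
  then show ?thesis
    using assms by (auto simp: compact_op_def bounded_clinear_add)
qed

definition pos_compact_op :: "('a::complex_inner \<Rightarrow> 'a) \<Rightarrow> bool" where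
  "pos_compact_op P \<longleftrightarrow> bounded_clinear P \<and> (\<forall>x y. P x \<bullet> y = x \<bullet> P y) \<and> (\<forall>x. 0 \<le> P x \<bullet> x)
    \<and> seq_compact_op P"

lemma pos_compact_opD:
  assumes "pos_compact_op P"
  shows "bounded_clinear P" "P x \<bullet> y = x \<bullet> P y" "cinner (P x) y = cinner x (P y)"
    "0 \<le> P x \<bullet> x" "seq_compact_op P"
  using assms cinner_adjointI[of P P] by (auto simp: pos_compact_op_def)

text \<open>The lower bound gives injectivity and the bound 1/\<delta> for the inverse. Surjectivity
  comes from that of the square of S: the functional of y is represented as
  \<open>S x \<bullet> S z\<close>, and self-adjointness moves the second S onto the first.\<close>

lemma selfadjoint_inverse:
  fixes S :: "'a::chilbert_space \<Rightarrow> 'a"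
  assumes S: "bounded_clinear S" "\<And>x y. S x \<bullet> y = x \<bullet> S y"
    and \<delta>: "\<delta> > 0" "\<And>x. \<delta> * norm x \<le> norm (S x)"
  shows "\<exists>R. bounded_clinear R \<and> (\<forall>x. R (S x) = x) \<and> (\<forall>x. S (R x) = x)"
proof -
  note lin = bounded_clinearD[OF S(1)]
  have "\<exists>x. S (S x) = y" for y
  proof -
    obtain x where x: "\<And>z. S x \<bullet> S z = y \<bullet> z"
      using coercive_representation[OF lin(1) bounded_linear_inner_right[of y] \<delta>] by auto
    have "S (S x) \<bullet> z = y \<bullet> z" for z
      using x[of z] S(2)[of "S x" z] by simp
    then show ?thesis
      by (metis vector_eq_rdot)
  qed
  then have "surj S"
    unfolding surj_def by metis
  then obtain R where R: "\<And>x. S (R x) = x"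
    by (metis surj_f_inv_f)
  have inj: "x = y" if "S x = S y" for x y
    using \<delta>(2)[of "x - y"] that \<delta>(1) by (simp add: lin mult_le_0_iff)
  have "R (x + y) = R x + R y" "R (c *\<^sub>C x) = c *\<^sub>C R x" "R (r *\<^sub>R x) = r *\<^sub>R R x" for x y c r
    by (rule inj; simp add: lin R)+
  moreover have "norm (R x) \<le> norm x * (1 / \<delta>)" for x
    using \<delta>(2)[of "R x"] \<delta>(1) by (simp add: R field_simps)
  ultimately have "bounded_clinear R"
    unfolding bounded_clinear_def by (auto intro!: bounded_linear_intro[where K = "1 / \<delta>"])
  moreover have "R (S x) = x" for x
    by (rule inj) (rule R)
  ultimately show ?thesis
    using R by blast
qed

section \<open>The real spectrum of a compact positive operator\<close>

lemma eigenvalue_in_op_spectrum: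
  assumes "P e = l *\<^sub>R e" "e \<noteq> 0"
  shows "complex_of_real l \<in> op_spectrum P"
proof -
  have False if "bounded_clinear S" "\<And>x. S (P x - complex_of_real l *\<^sub>C x) = x" for S
    using that(2)[of e] assms bounded_clinearD(6)[OF that(1)] by (simp add: scaleC_of_real)
  then show ?thesis
    unfolding op_spectrum_def by blast
qed

text \<open>P - t is self-adjoint because t is real, so a lower bound alone makes it invertible.
  \<open>cont_fun_calc\<close> sees the spectrum only through such real points.\<close>

lemma not_in_op_spectrumI:
  fixes P :: "'a::chilbert_space \<Rightarrow> 'a"
  assumes P: "pos_compact_op P" and \<delta>: "\<delta> > 0" "\<And>x. \<delta> * norm x \<le> norm (P x - t *\<^sub>R x)"
  shows "complex_of_real t \<notin> op_spectrum P"
proof -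
  note P' = pos_compact_opD[OF P]
  have eq: "complex_of_real t *\<^sub>C x = t *\<^sub>R x" for x :: 'a
    by (rule scaleC_of_real)
  have "bounded_linear (\<lambda>x. P x - t *\<^sub>R x)"
    by (intro bounded_linear_sub bounded_clinearD(1)[OF P'(1)] bounded_linear_scaleR_right)
  moreover have "P (c *\<^sub>C x) - t *\<^sub>R (c *\<^sub>C x) = c *\<^sub>C (P x - t *\<^sub>R x)" for c x
    unfolding eq[symmetric]
    by (simp add: bounded_clinearD[OF P'(1)] scaleC_scaleC mult.commute
        complex_vector.scale_right_diff_distrib)
  ultimately have "bounded_clinear (\<lambda>x. P x - t *\<^sub>R x)"
    by (simp add: bounded_clinear_def)
  moreover have "(P x - t *\<^sub>R x) \<bullet> y = x \<bullet> (P y - t *\<^sub>R y)" for x y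
    by (simp add: inner_diff_left inner_diff_right P'(2))
  ultimately show ?thesis
    using selfadjoint_inverse[of "\<lambda>x. P x - t *\<^sub>R x", OF _ _ \<delta>]
    by (simp add: op_spectrum_def eq)
qed

text \<open>Confines the real spectrum to a compact interval on which Weierstrass approximation
  applies. Outside it P - t is bounded below, by positivity for t < 0 and by the triangle inequality
  for t > K.\<close>

lemma op_spectrum_bounds:
  fixes P :: "'a::chilbert_space \<Rightarrow> 'a"
  assumes P: "pos_compact_op P" and K: "\<And>x. norm (P x) \<le> K * norm x"
    and t: "complex_of_real t \<in> op_spectrum P"
  shows "0 \<le> t" "t \<le> K"
proof -
  show "0 \<le> t"
  proof (rule ccontr)
    assume "\<not> 0 \<le> t"
    then have "t < 0" by simp
    have "- t * norm x \<le> norm (P x - t *\<^sub>R x)" for x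
    proof (rule power2_le_imp_le)
      have "(norm (P x - t *\<^sub>R x))\<^sup>2 = (norm (P x))\<^sup>2 - 2 * t * (P x \<bullet> x) + (- t * norm x)\<^sup>2"
        unfolding power2_norm_eq_inner power_mult_distrib
        by (simp add: algebra_simps inner_commute power2_eq_square)
      moreover have "t * (P x \<bullet> x) \<le> 0"
        using pos_compact_opD(4)[OF P, of x] \<open>t < 0\<close> by (simp add: mult_nonpos_nonneg)
      ultimately show "(- t * norm x)\<^sup>2 \<le> (norm (P x - t *\<^sub>R x))\<^sup>2"
        using zero_le_power2[of "norm (P x)"] by linarith
    qed simp
    then show False
      using not_in_op_spectrumI[OF P, of "- t" t] \<open>t < 0\<close> t by simp
  qed
  show "t \<le> K"
  proof (rule ccontr)
    assume "\<not> t \<le> K"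
    have "(t - K) * norm x \<le> norm (P x - t *\<^sub>R x)" for x
      using K[of x] norm_triangle_ineq2[of "t *\<^sub>R x" "P x"] \<open>0 \<le> t\<close>
      by (simp add: norm_minus_commute algebra_simps)
    then show False
      using not_in_op_spectrumI[OF P, of "t - K" t] \<open>\<not> t \<le> K\<close> t by simp
  qed
qed

lemma bounded_below_if_0_notin_op_spectrum:
  assumes "0 \<notin> op_spectrum P"
  shows "\<exists>\<delta>>0. \<forall>x. \<delta> * norm x \<le> norm (P x)"
proof -
  obtain S where S: "bounded_clinear S" "\<And>x. S (P x) = x"
    using assms by (auto simp: op_spectrum_def)
  obtain K where K: "K > 0" "\<And>x. norm (S x) \<le> norm x * K"
    using bounded_linear.pos_bounded[OF bounded_clinearD(1)[OF S(1)]] by blast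
  have "1 / K * norm x \<le> norm (P x)" for x
    using K(2)[of "P x"] K(1) by (simp add: S field_simps)
  then show ?thesis
    using K(1) by (intro exI[of _ "1 / K"]) auto
qed

text \<open>Maximising unit vectors \<open>x\<close> of \<open>\<parallel>P x\<parallel>\<close> are almost fixed by \<open>P\<^sup>2 / m\<^sup>2\<close>, so compactness makes
  them accumulate at an eigenvector.\<close>

lemma ex_eigenvector_in_invariant:
  fixes P :: "'a::complex_inner \<Rightarrow> 'a"
  assumes P: "pos_compact_op P"
    and W: "closed W" "subspace W" "\<And>x. x \<in> W \<Longrightarrow> P x \<in> W"
    and x0: "x0 \<in> W" "t * norm x0 < norm (P x0)" and "0 \<le> t"
  shows "\<exists>e\<in>W. \<exists>l>t. norm e = 1 \<and> P e = l *\<^sub>R e"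
proof -
  note P' = pos_compact_opD[OF P]
  note lin = bounded_clinearD[OF P'(1)]
  interpret P: bounded_linear P by (rule lin(1))
  obtain K where K: "\<And>x. norm (P x) \<le> norm x * K"
    using P.bounded by blast
  define S where "S = {norm (P x) | x. x \<in> W \<and> norm x = 1}"
  define m where "m = Sup S"
  have bdd: "bdd_above S"
  proof (rule bdd_aboveI[of _ K])
    fix c assume "c \<in> S"
    then obtain x where "c = norm (P x)" "norm x = 1"
      by (auto simp: S_def)
    then show "c \<le> K"
      using K[of x] by simp
  qed
  have "x0 \<noteq> 0"
    using x0(2) lin by auto
  have unit: "norm (P ((1 / norm x) *\<^sub>R x)) \<in> S" if "x \<in> W" "x \<noteq> 0" for x
    using that W(2) by (auto simp: S_def subspace_scale)
  have le_m: "norm (P x) \<le> m * norm x" if "x \<in> W" for x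
  proof (cases "x = 0")
    case False
    have "norm (P ((1 / norm x) *\<^sub>R x)) \<le> m"
      unfolding m_def using bdd unit that False by (intro cSup_upper) auto
    then show ?thesis
      using False by (simp add: lin field_simps)
  qed (use lin in simp)
  have "t * norm x0 < m * norm x0"
    using le_m[OF x0(1)] x0(2) by linarith
  then have "t < m"
    using \<open>x0 \<noteq> 0\<close> by simp
  then have "m > 0"
    using \<open>0 \<le> t\<close> by simp
  have "\<exists>x. x \<in> W \<and> norm x = 1 \<and> m - inverse (real (Suc n)) < norm (P x)" for n
    using less_cSupE[of "m - inverse (real (Suc n))" S] unit[OF x0(1) \<open>x0 \<noteq> 0\<close>]
    unfolding m_def S_def by force
  then obtain x where x: "\<And>n. x n \<in> W" "\<And>n. norm (x n) = 1"
    "\<And>n. m - inverse (real (Suc n)) < norm (P (x n))"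
    by metis
  have lim_m: "(\<lambda>n. norm (P (x n))) \<longlonglongrightarrow> m"
  proof (rule tendsto_sandwich)
    show "(\<lambda>n. m - inverse (real (Suc n))) \<longlonglongrightarrow> m"
      using tendsto_diff[OF tendsto_const[of m] LIMSEQ_inverse_real_of_nat] by simp
    show "\<forall>\<^sub>F n in sequentially. m - inverse (real (Suc n)) \<le> norm (P (x n))"
      using x(3) by (intro always_eventually) (auto intro: less_imp_le)
    show "\<forall>\<^sub>F n in sequentially. norm (P (x n)) \<le> m"
      using le_m[OF x(1)] x(2) by simp
  qed auto
  \<comment> \<open>Expand the square, using that <P(P z), z> is |P z|^2 and |P(P z)| is at most m
    |P z|. Along the maximising sequence the right side tends to 0.\<close>
  have bound: "(norm (P (P z) - m\<^sup>2 *\<^sub>R z))\<^sup>2 \<le> m\<^sup>2 * (m\<^sup>2 - (norm (P z))\<^sup>2)"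
    if "z \<in> W" "norm z = 1" for z
  proof -
    have "(norm (P (P z) - m\<^sup>2 *\<^sub>R z))\<^sup>2
        = (norm (P (P z)))\<^sup>2 - 2 * m\<^sup>2 * (P (P z) \<bullet> z) + m\<^sup>2 * m\<^sup>2 * (norm z)\<^sup>2"
      unfolding power2_norm_eq_inner by (simp add: algebra_simps inner_commute)
    also have "P (P z) \<bullet> z = (norm (P z))\<^sup>2"
      using P'(2)[of "P z" z] by (simp add: power2_norm_eq_inner)
    also have "(norm (P (P z)))\<^sup>2 \<le> (m * norm (P z))\<^sup>2"
      using le_m[OF W(3)[OF that(1)]] by (intro power_mono) auto
    finally show ?thesis
      using that(2) by (simp add: algebra_simps power_mult_distrib)
  qed
  have lim_sq: "(\<lambda>n. (norm (P (P (x n)) - m\<^sup>2 *\<^sub>R x n))\<^sup>2) \<longlonglongrightarrow> 0"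
  proof (rule tendsto_sandwich[where f = "\<lambda>_. 0"])
    have "(\<lambda>n. m\<^sup>2 * (m\<^sup>2 - (norm (P (x n)))\<^sup>2)) \<longlonglongrightarrow> m\<^sup>2 * (m\<^sup>2 - m\<^sup>2)"
      by (intro tendsto_intros lim_m)
    then show "(\<lambda>n. m\<^sup>2 * (m\<^sup>2 - (norm (P (x n)))\<^sup>2)) \<longlonglongrightarrow> 0"
      by simp
  qed (use bound x in auto)
  have "(\<lambda>n. norm (P (P (x n)) - m\<^sup>2 *\<^sub>R x n)) \<longlonglongrightarrow> 0"
    using tendsto_real_sqrt[OF lim_sq] by simp
  then have lim0: "(\<lambda>n. P (P (x n)) - m\<^sup>2 *\<^sub>R x n) \<longlonglongrightarrow> 0"
    by (rule tendsto_norm_zero_cancel)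
  have "bounded (range x)"
    using x(2) by (auto simp: bounded_iff)
  then obtain r y where r: "strict_mono r" and y: "(\<lambda>n. P (x (r n))) \<longlonglongrightarrow> y"
    using P'(5) unfolding seq_compact_op_def convergent_def by blast
  note lim0' = LIMSEQ_subseq_LIMSEQ[OF lim0 r, unfolded o_def]
  \<comment> \<open>The only possible limit of \<open>x (r n)\<close>: along the subsequence P(P x)
    tends to \<open>P y\<close>, and P(P x) - m^2 x tends to 0.\<close>
  define e where "e = (1 / m\<^sup>2) *\<^sub>R P y"
  have "(\<lambda>n. (1 / m\<^sup>2) *\<^sub>R (P (P (x (r n))) - (P (P (x (r n))) - m\<^sup>2 *\<^sub>R x (r n))))
      \<longlonglongrightarrow> (1 / m\<^sup>2) *\<^sub>R (P y - 0)"
    by (intro tendsto_intros P.tendsto y lim0')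
  then have e: "(\<lambda>n. x (r n)) \<longlonglongrightarrow> e"
    using \<open>m > 0\<close> by (simp add: e_def)
  have "e \<in> W"
    using W(1) x(1) by (intro closed_sequentially[OF _ _ e])
  have "(\<lambda>n. norm (x (r n))) \<longlonglongrightarrow> norm e"
    by (intro tendsto_intros e)
  then have "norm e = 1"
    using x(2) by (simp add: LIMSEQ_const_iff)
  have "(\<lambda>n. P (P (x (r n))) - m\<^sup>2 *\<^sub>R x (r n)) \<longlonglongrightarrow> P (P e) - m\<^sup>2 *\<^sub>R e"
    by (intro tendsto_intros P.tendsto e)
  from LIMSEQ_unique[OF this lim0'] have PP: "P (P e) = m\<^sup>2 *\<^sub>R e"
    by simp
  \<comment> \<open>P^2 - m^2 factors as (P + m)(P - m). A nonzero \<open>v\<close> would be an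
    eigenvector for -m < 0, which positivity excludes.\<close>
  define v where "v = P e - m *\<^sub>R e"
  have "P v = (- m) *\<^sub>R v"
    by (simp add: v_def lin PP algebra_simps power2_eq_square)
  then have "- m * (v \<bullet> v) \<ge> 0"
    using P'(4)[of v] by simp
  then have "v \<bullet> v \<le> 0"
    using \<open>m > 0\<close> by (simp add: mult_le_0_iff)
  then have "v = 0"
    by (metis inner_gt_zero_iff linorder_not_le)
  then show ?thesis
    using \<open>e \<in> W\<close> \<open>norm e = 1\<close> \<open>t < m\<close> by (auto simp: v_def)
qed

text \<open>An orthonormal basis of the sum of the eigenspaces of \<open>P\<close> for the eigenvalues above \<open>t\<close>.\<close>

definition eigenbasis_above :: "('a::complex_inner \<Rightarrow> 'a) \<Rightarrow> real \<Rightarrow> 'a set \<Rightarrow> bool" where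
  "eigenbasis_above P t E \<longleftrightarrow> finite E \<and> corthonormal (\<lambda>e. e) E \<and> (\<forall>e\<in>E. \<exists>l>t. P e = l *\<^sub>R e)
    \<and> (\<forall>x. (\<forall>e\<in>E. cinner x e = 0) \<longrightarrow> norm (P x) \<le> t * norm x)"

lemma cinner_eq_Complex: "cinner x y = Complex (x \<bullet> y) (x \<bullet> (\<i> *\<^sub>C y))"
  by (simp add: complex_eq_iff cinner_scaleC_right flip: Re_cinner)

text \<open>Images of two distinct members are orthogonal with norms above t, hence at distance at
  least t, so a sequence of distinct members has no subsequence with convergent images.\<close>

lemma finite_corthonormal_eigenvectors:
  fixes P :: "'a::complex_inner \<Rightarrow> 'a"
  assumes P: "seq_compact_op P" and t: "0 < t"
    and E: "corthonormal (\<lambda>e. e) E" "\<And>e. e \<in> E \<Longrightarrow> \<exists>l>t. P e = l *\<^sub>R e"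
  shows "finite E"
proof (rule ccontr)
  assume "infinite E"
  then obtain f :: "nat \<Rightarrow> 'a" where f: "inj f" "range f \<subseteq> E"
    using infinite_countable_subset by blast
  have inner: "f i \<bullet> f k = (if i = k then 1 else 0)" for i k
    using E(1) f by (auto simp: corthonormal_def inj_eq subset_iff simp flip: Re_cinner)
  have "norm (f n) = 1" for n
    by (simp add: norm_eq_sqrt_inner inner)
  then have "bounded (range f)"
    by (auto simp: bounded_iff)
  then obtain r where r: "strict_mono r" "convergent (\<lambda>n. P (f (r n)))"
    using P unfolding seq_compact_op_def by blast
  have "Cauchy (\<lambda>n. P (f (r n)))"
    by (rule convergent_Cauchy[OF r(2)])
  then obtain N where N: "\<And>m n. m \<ge> N \<Longrightarrow> n \<ge> N \<Longrightarrow> norm (P (f (r m)) - P (f (r n))) < t"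
    using CauchyD[of _ t] t by blast
  define i k where "i = r N" and "k = r (Suc N)"
  have "i \<noteq> k"
    using r(1) by (simp add: i_def k_def strict_mono_eq)
  obtain a b where ab: "a > t" "P (f i) = a *\<^sub>R f i" "b > t" "P (f k) = b *\<^sub>R f k"
    using E(2) f(2) by (metis rangeI subset_iff)
  have "(norm (P (f i) - P (f k)))\<^sup>2 = a\<^sup>2 + b\<^sup>2"
    using \<open>i \<noteq> k\<close> unfolding power2_norm_eq_inner ab(2,4)
    by (simp add: inner algebra_simps power2_eq_square)
  also have "\<dots> \<ge> t\<^sup>2"
    using ab t power_mono[of t a 2] by (simp add: add_increasing2)
  finally have "t \<le> norm (P (f i) - P (f k))"
    by (rule power2_le_imp_le) simp
  then show False
    using N[of N "Suc N"] by (simp add: i_def k_def)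
qed

lemma closed_orthogonal: "closed {x. \<forall>e\<in>E. cinner x e = 0}"
proof -
  have "{x. \<forall>e\<in>E. cinner x e = 0} = (\<Inter>e\<in>E. {x. x \<bullet> e = 0} \<inter> {x. x \<bullet> (\<i> *\<^sub>C e) = 0})"
    by (auto simp: cinner_eq_Complex complex_eq_iff)
  also have "closed \<dots>"
    by (intro closed_INT ballI closed_Int closed_Collect_eq continuous_intros)
  finally show ?thesis .
qed

lemma subspace_orthogonal: "subspace {x. \<forall>e\<in>E. cinner x e = 0}"
  by (auto simp: subspace_def cinner_add_left cinner_scaleR_left)

text \<open>Zorn provides a maximal orthonormal set of eigenvectors above t, finite by compactness.
  Its orthogonal complement is closed and invariant, so a vector there that P stretches by more than
  t would yield one more eigenvector.\<close>

lemma ex_eigenbasis_above: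
  fixes P :: "'a::complex_inner \<Rightarrow> 'a"
  assumes P: "pos_compact_op P" and t: "0 < t"
  shows "\<exists>E. eigenbasis_above P t E"
proof -
  note P' = pos_compact_opD[OF P]
  define A where "A = {E. corthonormal (\<lambda>e. e) E \<and> (\<forall>e\<in>E. \<exists>l>t. P e = l *\<^sub>R e)}"
  have "\<exists>M\<in>A. \<forall>X\<in>A. M \<subseteq> X \<longrightarrow> X = M"
  proof (rule subset_Zorn')
    fix C assume C: "subset.chain A C"
    show "\<Union>C \<in> A"
      unfolding A_def mem_Collect_eq corthonormal_def
    proof (intro conjI ballI)
      fix e f assume "e \<in> \<Union>C" "f \<in> \<Union>C"
      then obtain X Y where XY: "X \<in> C" "Y \<in> C" "e \<in> X" "f \<in> Y"
        by blast
      then obtain Z where "Z \<in> C" "e \<in> Z" "f \<in> Z"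
        using C unfolding subset.chain_def by blast
      moreover have "Z \<in> A"
        using C \<open>Z \<in> C\<close> unfolding subset.chain_def by blast
      ultimately show "cinner e f = (if e = f then 1 else 0)"
        by (auto simp: A_def corthonormal_def)
    next
      fix e assume "e \<in> \<Union>C"
      then show "\<exists>l>t. P e = l *\<^sub>R e"
        using C unfolding subset.chain_def A_def by blast
    qed
  qed
  then obtain E where E: "E \<in> A" and max: "\<And>X. X \<in> A \<Longrightarrow> E \<subseteq> X \<Longrightarrow> X = E"
    by blast
  have on: "corthonormal (\<lambda>e. e) E" and ev: "\<And>e. e \<in> E \<Longrightarrow> \<exists>l>t. P e = l *\<^sub>R e"
    using E by (auto simp: A_def)
  have fin: "finite E"
    using finite_corthonormal_eigenvectors[OF P'(5) t on ev] .
  have "norm (P x) \<le> t * norm x" if x: "\<forall>e\<in>E. cinner x e = 0" for x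
  proof (rule ccontr)
    assume nle: "\<not> norm (P x) \<le> t * norm x"
    define W where "W = {x. \<forall>e\<in>E. cinner x e = 0}"
    have "P z \<in> W" if "z \<in> W" for z
      unfolding W_def
    proof safe
      fix e assume "e \<in> E"
      then obtain l where "P e = complex_of_real l *\<^sub>C e"
        using ev by (metis scaleC_of_real)
      then show "cinner (P z) e = 0"
        using that \<open>e \<in> E\<close> by (simp add: P'(3) cinner_scaleC_right W_def)
    qed
    then obtain e l where e: "e \<in> W" "l > t" "norm e = 1" "P e = l *\<^sub>R e"
      using ex_eigenvector_in_invariant[OF P, of W x t] x nle t
        closed_orthogonal[of E] subspace_orthogonal[of E] unfolding W_def by auto
    have "cinner e f = 0" "cinner f e = 0" if "f \<in> E" for f
      using e(1) that cinner_commute[of f e] by (auto simp: W_def)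
    then have "insert e E \<in> A"
      using E e cinner_self[of e] by (auto simp: A_def corthonormal_def)
    then have "e \<in> E"
      using max by blast
    then have "cinner e e = 0"
      using e(1) by (simp add: W_def)
    then show False
      using e(3) by (simp add: cinner_self)
  qed
  then show ?thesis
    using on ev fin by (auto simp: eigenbasis_above_def)
qed

section \<open>Functional calculus\<close>

lemma poly_op_eq_sum:
  assumes "degree p \<le> n"
  shows "poly_op p T x = (\<Sum>i\<le>n. coeff p i *\<^sub>R (T ^^ i) x)"
  unfolding poly_op_def using assms
  by (intro sum.mono_neutral_left) (auto simp: coeff_eq_0)

lemma poly_op_0 [simp]: "poly_op 0 T x = 0"
  by (simp add: poly_op_def)

lemma poly_op_add: "poly_op (p + q) T x = poly_op p T x + poly_op q T x"
  using poly_op_eq_sum[of "p + q" "max (degree p) (degree q)" T x]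
    poly_op_eq_sum[of p "max (degree p) (degree q)" T x]
    poly_op_eq_sum[of q "max (degree p) (degree q)" T x]
  by (simp add: degree_add_le scaleR_add_left sum.distrib)

lemma poly_op_smult: "poly_op (smult c p) T x = c *\<^sub>R poly_op p T x"
  using poly_op_eq_sum[of "smult c p" "degree p" T x]
  by (simp add: poly_op_def degree_smult_le scaleR_sum_right)

lemma poly_op_diff: "poly_op (p - q) T x = poly_op p T x - poly_op q T x"
  using poly_op_add[of "p - q" q T x] by simp

lemma poly_op_pCons:
  assumes "bounded_clinear T"
  shows "poly_op (pCons a p) T x = a *\<^sub>R x + T (poly_op p T x)"
proof -
  have "poly_op (pCons a p) T x = (\<Sum>i\<le>Suc (degree p). coeff (pCons a p) i *\<^sub>R (T ^^ i) x)"
    by (rule poly_op_eq_sum) (rule degree_pCons_le)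
  also have "\<dots> = a *\<^sub>R x + (\<Sum>i\<le>degree p. coeff p i *\<^sub>R T ((T ^^ i) x))"
    by (subst sum.atMost_Suc_shift) simp
  finally show ?thesis
    by (simp add: poly_op_def bounded_clinearD[OF assms])
qed

lemma bounded_clinear_poly_op:
  assumes T: "bounded_clinear T"
  shows "bounded_clinear (poly_op p T)"
proof (induction p rule: pCons_induct)
  case 0
  show ?case
    by (simp add: bounded_clinear_def bounded_linear_zero poly_op_def)
next
  case (pCons a p)
  have "bounded_clinear (\<lambda>x. T (poly_op p T x))"
    using T pCons.IH by (rule bounded_clinear_compose)
  moreover have "bounded_clinear (\<lambda>x. a *\<^sub>R x)"
    by (simp add: bounded_clinear_def bounded_linear_scaleC_right scaleC_scaleC mult.commute
        flip: scaleC_of_real)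
  ultimately have "bounded_clinear (\<lambda>x. a *\<^sub>R x + T (poly_op p T x))"
    by (intro bounded_clinear_add)
  then show ?case
    by (simp add: poly_op_pCons[OF T, abs_def])
qed

lemma poly_op_commute:
  assumes T: "bounded_clinear T"
  shows "poly_op p T (T x) = T (poly_op p T x)"
  by (induction p) (simp_all add: poly_op_pCons[OF T] bounded_clinearD[OF T])

lemma poly_op_mult:
  assumes T: "bounded_clinear T"
  shows "poly_op (p * q) T x = poly_op p T (poly_op q T x)"
  by (induction p) (simp_all add: poly_op_pCons[OF T] poly_op_add poly_op_smult)

lemma inner_poly_op:
  assumes T: "bounded_clinear T" "\<And>x y. T x \<bullet> y = x \<bullet> T y"
  shows "poly_op p T x \<bullet> y = x \<bullet> poly_op p T y"
proof (induction p arbitrary: x rule: pCons_induct)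
  case (pCons a p)
  have "poly_op (pCons a p) T x \<bullet> y = a * (x \<bullet> y) + poly_op p T (T x) \<bullet> y"
    by (simp add: poly_op_pCons[OF T(1)] poly_op_commute[OF T(1)] inner_add_left)
  also have "\<dots> = x \<bullet> poly_op (pCons a p) T y"
    by (simp add: pCons.IH poly_op_pCons[OF T(1)] inner_add_right T(2))
  finally show ?case .
qed simp

lemma poly_op_eigenvector:
  assumes T: "bounded_clinear T" and e: "T e = l *\<^sub>R e"
  shows "poly_op p T e = poly p l *\<^sub>R e"
  by (induction p)
    (simp_all add: poly_op_pCons[OF T] bounded_clinearD[OF T] e algebra_simps)

text \<open>On the span of E polynomials in P act diagonally, with factors bounded by c because
  eigenvalues lie in the spectrum; on the complement the bound d is assumed. Both parts have
  orthogonal images, so Pythagoras combines the bounds without adding them.\<close>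

lemma eigenbasis_above_poly_op_bound:
  fixes P :: "'a::chilbert_space \<Rightarrow> 'a"
  assumes P: "pos_compact_op P" and E: "eigenbasis_above P t E"
    and c: "\<And>t. complex_of_real t \<in> op_spectrum P \<Longrightarrow> \<bar>poly p t\<bar> \<le> c"
    and d: "\<And>z. norm (P z) \<le> t * norm z \<Longrightarrow> norm (poly_op p P z) \<le> d * norm z"
    and "c \<le> d" "0 \<le> c"
  shows "norm (poly_op p P x) \<le> d * norm x"
proof -
  note P' = pos_compact_opD[OF P]
  let ?p = "poly_op p P"
  note p_lin = bounded_clinearD[OF bounded_clinear_poly_op[OF P'(1), of p]]
  have fin: "finite E" and on: "corthonormal (\<lambda>e. e) E"
    and small: "\<And>z. (\<And>e. e \<in> E \<Longrightarrow> cinner z e = 0) \<Longrightarrow> norm (P z) \<le> t * norm z"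
    using E by (auto simp: eigenbasis_above_def)
  obtain l where l: "\<And>e. e \<in> E \<Longrightarrow> P e = l e *\<^sub>R e"
    using E unfolding eigenbasis_above_def by metis
  have l_bound: "\<bar>poly p (l e)\<bar> \<le> c" if "e \<in> E" for e
  proof (rule c, rule eigenvalue_in_op_spectrum)
    show "P e = l e *\<^sub>R e"
      by (rule l[OF that])
    have "cinner e e = 1"
      using on that by (simp add: corthonormal_def)
    then show "e \<noteq> 0"
      by auto
  qed
  have p_sum: "?p (\<Sum>e\<in>E. a e *\<^sub>C e) = (\<Sum>e\<in>E. (a e * poly p (l e)) *\<^sub>C e)" for a
    unfolding p_lin
    by (intro sum.cong)
      (auto simp: p_lin poly_op_eigenvector[OF P'(1) l] scaleC_scaleC simp flip: scaleC_of_real)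
  define x1 x2 where "x1 = (\<Sum>e\<in>E. cinner x e *\<^sub>C e)" and "x2 = x - x1"
  have x: "x = x1 + x2"
    by (simp add: x2_def)
  have orth: "(\<Sum>e\<in>E. a e *\<^sub>C e) \<bullet> x2 = 0" for a
    using cinner_sum_residual[OF fin on, of a x] by (simp add: x2_def x1_def flip: Re_cinner)
  have "(norm (?p x1))\<^sup>2 = (\<Sum>e\<in>E. (cmod (cinner x e * poly p (l e)))\<^sup>2)"
    unfolding x1_def p_sum by (rule norm_sum_corthonormal[OF fin on])
  also have "\<dots> \<le> (\<Sum>e\<in>E. d\<^sup>2 * (cmod (cinner x e))\<^sup>2)"
  proof (rule sum_mono)
    fix e assume "e \<in> E"
    then have "(poly p (l e))\<^sup>2 \<le> d\<^sup>2"
      using power_mono[OF order_trans[OF l_bound \<open>c \<le> d\<close>], of e 2] by simp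
    then show "(cmod (cinner x e * poly p (l e)))\<^sup>2 \<le> d\<^sup>2 * (cmod (cinner x e))\<^sup>2"
      using mult_right_mono[of _ _ "(cmod (cinner x e))\<^sup>2"]
      by (simp add: norm_mult power_mult_distrib mult.commute)
  qed
  also have "\<dots> = d\<^sup>2 * (norm x1)\<^sup>2"
    unfolding x1_def norm_sum_corthonormal[OF fin on] by (simp add: sum_distrib_left)
  finally have n1: "(norm (?p x1))\<^sup>2 \<le> d\<^sup>2 * (norm x1)\<^sup>2" .
  have "norm (P x2) \<le> t * norm x2"
    by (rule small) (simp add: x2_def x1_def corthonormal_residual[OF fin on])
  then have "(norm (?p x2))\<^sup>2 \<le> (d * norm x2)\<^sup>2"
    by (intro power_mono d) auto
  then have n2: "(norm (?p x2))\<^sup>2 \<le> d\<^sup>2 * (norm x2)\<^sup>2"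
    by (simp add: power_mult_distrib)
  have "?p x1 \<bullet> ?p x2 = 0"
    unfolding x1_def inner_poly_op[OF P'(1,2), symmetric] p_sum by (rule orth)
  then have "(norm (?p x))\<^sup>2 = (norm (?p x1))\<^sup>2 + (norm (?p x2))\<^sup>2"
    unfolding x p_lin power2_norm_eq_inner by (simp add: algebra_simps inner_commute)
  also have "\<dots> \<le> d\<^sup>2 * ((norm x1)\<^sup>2 + (norm x2)\<^sup>2)"
    using n1 n2 by (simp add: distrib_left)
  also have "(norm x1)\<^sup>2 + (norm x2)\<^sup>2 = (norm x)\<^sup>2"
    using orth[of "cinner x", folded x1_def] unfolding x power2_norm_eq_inner
    by (simp add: algebra_simps inner_commute)
  finally have "(norm (?p x))\<^sup>2 \<le> (d * norm x)\<^sup>2"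
    by (simp add: power_mult_distrib)
  then show ?thesis
    using \<open>c \<le> d\<close> \<open>0 \<le> c\<close> by (intro power2_le_imp_le[OF _ mult_nonneg_nonneg]) auto
qed

text \<open>What remains below a small threshold is controlled in one of two ways. If 0 is outside
  the spectrum, P is bounded below by some \<delta>, and the threshold \<delta>/2 leaves only the
  zero vector. If 0 is in the spectrum, p = a + X q with |a| = |p(0)| at most c, so the remainder
  costs at most c + M t, and t tends to 0.\<close>

lemma norm_poly_op_le:
  fixes P :: "'a::chilbert_space \<Rightarrow> 'a"
  assumes P: "pos_compact_op P" and "0 \<le> c"
    and c: "\<And>t. complex_of_real t \<in> op_spectrum P \<Longrightarrow> \<bar>poly p t\<bar> \<le> c"
  shows "norm (poly_op p P x) \<le> c * norm x"
proof (cases "0 \<in> op_spectrum P")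
  case False
  then obtain \<delta> where \<delta>: "\<delta> > 0" "\<And>x. \<delta> * norm x \<le> norm (P x)"
    using bounded_below_if_0_notin_op_spectrum by blast
  obtain E where E: "eigenbasis_above P (\<delta> / 2) E"
    using ex_eigenbasis_above[OF P] \<delta>(1) half_gt_zero by blast
  show ?thesis
  proof (rule eigenbasis_above_poly_op_bound[OF P E c])
    fix z assume "norm (P z) \<le> \<delta> / 2 * norm z"
    then have "\<delta> * norm z \<le> \<delta> / 2 * norm z"
      using \<delta>(2)[of z] by linarith
    then have "z = 0"
      using \<delta>(1) by simp
    then show "norm (poly_op p P z) \<le> c * norm z"
      using bounded_clinearD(6)[OF bounded_clinear_poly_op[OF pos_compact_opD(1)[OF P]], of p]
      by simp
  qed (use \<open>0 \<le> c\<close> in auto)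
next
  case True
  note P' = pos_compact_opD[OF P]
  obtain a q where p: "p = pCons a q"
    by (metis pCons_cases)
  have a: "\<bar>a\<bar> \<le> c"
    using c[of 0] True by (simp add: p)
  obtain M where M: "\<And>z. norm (poly_op q P z) \<le> norm z * M" "M \<ge> 0"
    using bounded_linear.nonneg_bounded[OF bounded_clinearD(1)[OF bounded_clinear_poly_op]] P'(1)
    by blast
  have *: "norm (poly_op p P x) \<le> (c + M * t) * norm x" if "t > 0" for t
  proof -
    obtain E where E: "eigenbasis_above P t E"
      using ex_eigenbasis_above[OF P \<open>t > 0\<close>] by blast
    show ?thesis
    proof (rule eigenbasis_above_poly_op_bound[OF P E c])
      fix z assume z: "norm (P z) \<le> t * norm z"
      have "poly_op p P z = a *\<^sub>R z + poly_op q P (P z)"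
        unfolding p poly_op_pCons[OF P'(1)] poly_op_commute[OF P'(1)] by simp
      then have "norm (poly_op p P z) \<le> \<bar>a\<bar> * norm z + norm (poly_op q P (P z))"
        by (metis norm_scaleR norm_triangle_ineq)
      also have "\<dots> \<le> c * norm z + (t * norm z) * M"
        using M(1)[of "P z"] mult_right_mono[OF z M(2)] mult_right_mono[OF a, of "norm z"]
        by (simp add: mult.commute)
      finally show "norm (poly_op p P z) \<le> (c + M * t) * norm z"
        by (simp add: algebra_simps)
    qed (use that M(2) \<open>0 \<le> c\<close> in auto)
  qed
  show ?thesis
  proof (rule field_le_epsilon)
    fix e :: real assume "e > 0"
    define t where "t = e / (M * norm x + 1)"
    have pos: "M * norm x + 1 > 0"
      using M(2) by (simp add: add_nonneg_pos)
    have "M * t * norm x \<le> e"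
      using \<open>e > 0\<close> pos by (simp add: t_def field_simps)
    moreover have "t > 0"
      using \<open>e > 0\<close> pos by (simp add: t_def)
    ultimately show "norm (poly_op p P x) \<le> c * norm x + e"
      using *[of t] by (simp add: algebra_simps)
  qed
qed

section \<open>Continuous functions of a compact positive operator\<close>

lemma Weierstrass_poly_uniform_limit:
  fixes f :: "real \<Rightarrow> real"
  assumes "continuous_on {a..b} f"
  shows "\<exists>p. uniform_limit {a..b} (\<lambda>n t. poly (p n) t) f sequentially"
proof -
  have "\<exists>q. \<forall>t\<in>{a..b}. \<bar>f t - poly q t\<bar> < e" if "e > 0" for e
  proof -
    obtain g where g: "real_polynomial_function g" "\<And>t. t \<in> {a..b} \<Longrightarrow> \<bar>f t - g t\<bar> < e"
      using Stone_Weierstrass_real_polynomial_function[OF compact_Icc assms \<open>e > 0\<close>] by blast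
    then obtain c n where "g = (\<lambda>t. \<Sum>i\<le>n. c i * t ^ i)"
      by (auto simp: real_polynomial_function_iff_sum)
    then have "poly (\<Sum>i\<le>n. monom (c i) i) = g"
      by (auto simp: poly_sum poly_monom)
    then show ?thesis
      using g(2) by metis
  qed
  then have "\<forall>n. \<exists>q. \<forall>t\<in>{a..b}. \<bar>f t - poly q t\<bar> < inverse (real (Suc n))"
    by simp
  then obtain p where p: "\<And>n t. t \<in> {a..b} \<Longrightarrow> \<bar>f t - poly (p n) t\<bar> < inverse (real (Suc n))"
    by metis
  have "uniform_limit {a..b} (\<lambda>n t. poly (p n) t) f sequentially"
    unfolding uniform_limit_iff
  proof (intro allI impI)
    fix e :: real assume "e > 0"
    have "\<forall>\<^sub>F n in sequentially. inverse (real (Suc n)) < e"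
      using LIMSEQ_inverse_real_of_nat \<open>e > 0\<close> by (auto dest: order_tendstoD)
    then show "\<forall>\<^sub>F n in sequentially. \<forall>t\<in>{a..b}. dist (poly (p n) t) (f t) < e"
    proof eventually_elim
      case (elim n)
      then show ?case
        using p[of _ n] by (force simp: dist_real_def abs_minus_commute)
    qed
  qed
  then show ?thesis
    by blast
qed

lemma ex_poly_uniform_limit_op_spectrum:
  fixes P :: "'a::chilbert_space \<Rightarrow> 'a"
  assumes P: "pos_compact_op P" and f: "continuous_on {0..} f"
  shows "\<exists>p. uniform_limit {t. complex_of_real t \<in> op_spectrum P} (\<lambda>n t. poly (p n) t) f sequentially"
    and "bounded (f ` {t. complex_of_real t \<in> op_spectrum P})"
proof -
  obtain K where "\<And>x. norm (P x) \<le> norm x * K"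
    using bounded_linear.bounded[OF bounded_clinearD(1)[OF pos_compact_opD(1)[OF P]]] by blast
  then have sub: "{t. complex_of_real t \<in> op_spectrum P} \<subseteq> {0..K}"
    using op_spectrum_bounds[OF P, of K] by (auto simp: mult.commute)
  have f': "continuous_on {0..K} f"
    by (rule continuous_on_subset[OF f]) auto
  show "\<exists>p. uniform_limit {t. complex_of_real t \<in> op_spectrum P} (\<lambda>n t. poly (p n) t) f sequentially"
    using Weierstrass_poly_uniform_limit[OF f'] uniform_limit_on_subset[OF _ sub] by blast
  show "bounded (f ` {t. complex_of_real t \<in> op_spectrum P})"
    using compact_continuous_image[OF f' compact_Icc] sub
    by (meson bounded_subset compact_imp_bounded image_mono)
qed

lemma poly_op_tendsto:
  fixes P :: "'a::chilbert_space \<Rightarrow> 'a"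
  assumes P: "pos_compact_op P"
    and lim: "uniform_limit {t. complex_of_real t \<in> op_spectrum P} (\<lambda>n t. poly (p n) t) (poly q)
      sequentially"
  shows "(\<lambda>n. poly_op (p n) P x) \<longlonglongrightarrow> poly_op q P x"
proof (rule metric_LIMSEQ_I)
  fix e :: real assume "e > 0"
  define d where "d = e / (norm x + 1)"
  have "norm x + 1 > 0"
    by (simp add: add_nonneg_pos)
  then have d: "d > 0" "d * norm x < e"
    using \<open>e > 0\<close> by (auto simp: d_def field_simps)
  then obtain N where N: "\<And>n t. n \<ge> N \<Longrightarrow> complex_of_real t \<in> op_spectrum P
      \<Longrightarrow> dist (poly (p n) t) (poly q t) < d"
    using lim unfolding uniform_limit_iff eventually_sequentially by blast
  have "dist (poly_op (p n) P x) (poly_op q P x) < e" if "n \<ge> N" for n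
  proof -
    have "norm (poly_op (p n - q) P x) \<le> d * norm x"
      using N[OF that] d(1) by (intro norm_poly_op_le[OF P]) (auto simp: dist_real_def intro: less_imp_le)
    then show ?thesis
      using d(2) by (simp add: poly_op_diff dist_norm)
  qed
  then show "\<exists>N. \<forall>n\<ge>N. dist (poly_op (p n) P x) (poly_op q P x) < e"
    by blast
qed

text \<open>The error bound against every polynomial, rather than the limit of one sequence, makes
  the operator independent of the approximating sequence, as the description in
  \<open>cont_fun_calc\<close> demands.\<close>

lemma ex_functional_calculus:
  fixes P :: "'a::chilbert_space \<Rightarrow> 'a"
  assumes P: "pos_compact_op P" and f: "continuous_on {0..} f"
  shows "\<exists>Q. bounded_clinear Q \<and> (\<forall>p c x. 0 \<le> c
    \<longrightarrow> (\<forall>t. complex_of_real t \<in> op_spectrum P \<longrightarrow> \<bar>poly p t - f t\<bar> \<le> c)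
    \<longrightarrow> norm (poly_op p P x - Q x) \<le> c * norm x)"
proof -
  note P' = pos_compact_opD[OF P]
  define \<sigma> where "\<sigma> = {t. complex_of_real t \<in> op_spectrum P}"
  obtain p where p: "uniform_limit \<sigma> (\<lambda>n t. poly (p n) t) f sequentially"
    unfolding \<sigma>_def using ex_poly_uniform_limit_op_spectrum(1)[OF P f] by blast
  have near: "\<exists>N. \<forall>n\<ge>N. \<forall>t\<in>\<sigma>. \<bar>poly (p n) t - f t\<bar> < e" if "e > 0" for e
    using p that unfolding uniform_limit_iff eventually_sequentially dist_real_def by blast
  have diff: "norm (poly_op q P x - poly_op r P x) \<le> c * norm x"
    if "0 \<le> c" "\<And>t. t \<in> \<sigma> \<Longrightarrow> \<bar>poly q t - poly r t\<bar> \<le> c" for q r c x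
    using norm_poly_op_le[OF P that(1), of "q - r" x] that(2) by (simp add: \<sigma>_def poly_op_diff)
  \<comment> \<open>Completeness in operator norm comes from the type of bounded real-linear maps;
    complex homogeneity is recovered afterwards from pointwise limits.\<close>
  define B where "B n = Blinfun (poly_op (p n) P)" for n
  have B: "blinfun_apply (B n) = poly_op (p n) P" for n
    unfolding B_def
    by (intro bounded_linear_Blinfun_apply bounded_clinearD(1) bounded_clinear_poly_op P'(1))
  have "Cauchy B"
  proof (rule metric_CauchyI)
    fix e :: real assume "e > 0"
    then obtain N where N: "\<And>n t. n \<ge> N \<Longrightarrow> t \<in> \<sigma> \<Longrightarrow> \<bar>poly (p n) t - f t\<bar> < e / 4"
      using near[of "e / 4"] by auto
    have "dist (B k) (B l) < e" if "k \<ge> N" "l \<ge> N" for k l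
    proof -
      have "norm (B k - B l) \<le> e / 2"
      proof (rule norm_blinfun_bound)
        fix x
        show "norm (blinfun_apply (B k - B l) x) \<le> e / 2 * norm x"
          unfolding blinfun.diff_left B
        proof (rule diff)
          fix t assume "t \<in> \<sigma>"
          then show "\<bar>poly (p k) t - poly (p l) t\<bar> \<le> e / 2"
            using N[OF \<open>k \<ge> N\<close> \<open>t \<in> \<sigma>\<close>] N[OF \<open>l \<ge> N\<close> \<open>t \<in> \<sigma>\<close>] \<open>e > 0\<close> by linarith
        qed (use \<open>e > 0\<close> in auto)
      qed (use \<open>e > 0\<close> in auto)
      then show ?thesis
        using \<open>e > 0\<close> by (simp add: dist_norm)
    qed
    then show "\<exists>N. \<forall>k\<ge>N. \<forall>l\<ge>N. dist (B k) (B l) < e"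
      by blast
  qed
  then obtain Q' where Q': "B \<longlonglongrightarrow> Q'"
    using Cauchy_convergent convergent_def by blast
  define Q where "Q = blinfun_apply Q'"
  have lim: "(\<lambda>n. poly_op (p n) P x) \<longlonglongrightarrow> Q x" for x
    using blinfun.tendsto[OF Q' tendsto_const[of x]] by (simp add: B Q_def)
  have "Q (c *\<^sub>C x) = c *\<^sub>C Q x" for c x
  proof (rule LIMSEQ_unique)
    show "(\<lambda>n. poly_op (p n) P (c *\<^sub>C x)) \<longlonglongrightarrow> Q (c *\<^sub>C x)"
      by (rule lim)
    have "(\<lambda>n. c *\<^sub>C poly_op (p n) P x) \<longlonglongrightarrow> c *\<^sub>C Q x"
      using lim by (rule bounded_linear.tendsto[OF bounded_linear_scaleC_right])
    then show "(\<lambda>n. poly_op (p n) P (c *\<^sub>C x)) \<longlonglongrightarrow> c *\<^sub>C Q x"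
      by (simp add: bounded_clinearD(2)[OF bounded_clinear_poly_op[OF P'(1)]])
  qed
  then have "bounded_clinear Q"
    by (simp add: bounded_clinear_def Q_def blinfun.bounded_linear_right)
  moreover have "norm (poly_op q P x - Q x) \<le> c * norm x"
    if "0 \<le> c" and c: "\<And>t. t \<in> \<sigma> \<Longrightarrow> \<bar>poly q t - f t\<bar> \<le> c" for q c x
  proof (rule field_le_epsilon)
    fix e :: real assume "e > 0"
    define d where "d = e / (norm x + 1)"
    have "norm x + 1 > 0"
      by (simp add: add_nonneg_pos)
    then have d: "d > 0" "d * norm x \<le> e"
      using \<open>e > 0\<close> by (auto simp: d_def field_simps)
    obtain N where N: "\<And>n t. n \<ge> N \<Longrightarrow> t \<in> \<sigma> \<Longrightarrow> \<bar>poly (p n) t - f t\<bar> < d"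
      using near[OF d(1)] by blast
    have "norm (poly_op q P x - poly_op (p n) P x) \<le> (c + d) * norm x" if "n \<ge> N" for n
    proof (rule diff)
      fix t assume "t \<in> \<sigma>"
      then show "\<bar>poly q t - poly (p n) t\<bar> \<le> c + d"
        using N[OF that \<open>t \<in> \<sigma>\<close>] c[of t] by linarith
    qed (use \<open>0 \<le> c\<close> d in auto)
    moreover have "(\<lambda>n. norm (poly_op q P x - poly_op (p n) P x)) \<longlonglongrightarrow> norm (poly_op q P x - Q x)"
      by (intro tendsto_intros lim)
    ultimately have "norm (poly_op q P x - Q x) \<le> (c + d) * norm x"
      by (intro LIMSEQ_le_const2) auto
    then show "norm (poly_op q P x - Q x) \<le> c * norm x + e"
      using d(2) by (simp add: distrib_right)
  qed
  ultimately show ?thesis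
    unfolding \<sigma>_def by blast
qed

text \<open>Uniqueness rests on Weierstrass: if no polynomial sequence converged to f uniformly on
  the spectrum, the defining condition would hold vacuously for every bounded operator.\<close>

lemma cont_fun_calc_works:
  fixes P :: "'a::chilbert_space \<Rightarrow> 'a"
  assumes P: "pos_compact_op P" and f: "continuous_on {0..} f"
  shows "bounded_clinear (cont_fun_calc f P)"
    and "0 \<le> c \<Longrightarrow> (\<And>t. complex_of_real t \<in> op_spectrum P \<Longrightarrow> \<bar>poly p t - f t\<bar> \<le> c)
      \<Longrightarrow> norm (poly_op p P x - cont_fun_calc f P x) \<le> c * norm x"
proof -
  define \<sigma> where "\<sigma> = {t. complex_of_real t \<in> op_spectrum P}"
  obtain Q where Q: "bounded_clinear Q"
    and Q_near: "\<And>p c x. 0 \<le> c \<Longrightarrow> (\<And>t. t \<in> \<sigma> \<Longrightarrow> \<bar>poly p t - f t\<bar> \<le> c)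
      \<Longrightarrow> norm (poly_op p P x - Q x) \<le> c * norm x"
    using ex_functional_calculus[OF P f] unfolding \<sigma>_def by auto
  have bl: "bounded_linear (\<lambda>x. poly_op q P x - R x)" if "bounded_clinear R" for q R
    using that pos_compact_opD(1)[OF P]
    by (intro bounded_linear_sub bounded_clinearD(1) bounded_clinear_poly_op)
  define good where "good R \<longleftrightarrow> bounded_clinear R \<and>
    (\<forall>p. uniform_limit \<sigma> (\<lambda>n t. poly (p n) t) f sequentially
      \<longrightarrow> (\<lambda>n. onorm (\<lambda>x. poly_op (p n) P x - R x)) \<longlonglongrightarrow> 0)" for R
  have "good Q"
    unfolding good_def
  proof (intro conjI allI impI Q)
    fix p assume p: "uniform_limit \<sigma> (\<lambda>n t. poly (p n) t) f sequentially"
    show "(\<lambda>n. onorm (\<lambda>x. poly_op (p n) P x - Q x)) \<longlonglongrightarrow> 0"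
    proof (rule LIMSEQ_I)
      fix e :: real assume "e > 0"
      then obtain N where N: "\<And>n t. n \<ge> N \<Longrightarrow> t \<in> \<sigma> \<Longrightarrow> dist (poly (p n) t) (f t) < e / 2"
        using p half_gt_zero unfolding uniform_limit_iff eventually_sequentially by metis
      have "norm (onorm (\<lambda>x. poly_op (p n) P x - Q x) - 0) < e" if "n \<ge> N" for n
      proof -
        have "onorm (\<lambda>x. poly_op (p n) P x - Q x) \<le> e / 2"
          using N[OF that] \<open>e > 0\<close>
          by (intro onorm_bound Q_near) (auto simp: dist_real_def intro: less_imp_le)
        then show ?thesis
          using onorm_pos_le[OF bl[OF Q]] \<open>e > 0\<close> by simp
      qed
      then show "\<exists>N. \<forall>n\<ge>N. norm (onorm (\<lambda>x. poly_op (p n) P x - Q x) - 0) < e"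
        by blast
    qed
  qed
  moreover have "R = Q" if "good R" for R
  proof
    fix x
    obtain p where p: "uniform_limit \<sigma> (\<lambda>n t. poly (p n) t) f sequentially"
      unfolding \<sigma>_def using ex_poly_uniform_limit_op_spectrum(1)[OF P f] by blast
    have lim: "(\<lambda>n. poly_op (p n) P x) \<longlonglongrightarrow> S x" if "good S" for S
    proof -
      have S: "bounded_clinear S" and lim0: "(\<lambda>n. onorm (\<lambda>x. poly_op (p n) P x - S x)) \<longlonglongrightarrow> 0"
        using that p by (auto simp: good_def)
      have "(\<lambda>n. poly_op (p n) P x - S x) \<longlonglongrightarrow> 0"
        by (rule Lim_null_comparison[OF _ tendsto_mult_left_zero[OF lim0, of "norm x"]])
          (auto intro: always_eventually onorm[OF bl[OF S]])
      then show ?thesis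
        by (rule LIM_zero_cancel)
    qed
    show "R x = Q x"
      using lim[OF \<open>good R\<close>] lim[OF \<open>good Q\<close>] by (rule LIMSEQ_unique)
  qed
  ultimately have "(THE R. good R) = Q"
    by (rule the_equality)
  then have eq: "cont_fun_calc f P = Q"
    unfolding cont_fun_calc_def good_def \<sigma>_def .
  show "bounded_clinear (cont_fun_calc f P)"
    using Q by (simp add: eq)
  show "norm (poly_op p P x - cont_fun_calc f P x) \<le> c * norm x"
    if "0 \<le> c" "\<And>t. complex_of_real t \<in> op_spectrum P \<Longrightarrow> \<bar>poly p t - f t\<bar> \<le> c"
    unfolding eq using that by (intro Q_near) (auto simp: \<sigma>_def)
qed

lemma poly_op_tendsto_cont_fun_calc:
  fixes P :: "'a::chilbert_space \<Rightarrow> 'a"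
  assumes P: "pos_compact_op P" and f: "continuous_on {0..} f"
    and lim: "uniform_limit {t. complex_of_real t \<in> op_spectrum P} (\<lambda>n t. poly (p n) t) f sequentially"
  shows "(\<lambda>n. poly_op (p n) P x) \<longlonglongrightarrow> cont_fun_calc f P x"
proof (rule metric_LIMSEQ_I)
  fix e :: real assume "e > 0"
  define d where "d = e / (norm x + 1)"
  have "norm x + 1 > 0"
    by (simp add: add_nonneg_pos)
  then have d: "d > 0" "d * norm x < e"
    using \<open>e > 0\<close> by (auto simp: d_def field_simps)
  then obtain N where N: "\<And>n t. n \<ge> N \<Longrightarrow> complex_of_real t \<in> op_spectrum P
      \<Longrightarrow> dist (poly (p n) t) (f t) < d"
    using lim unfolding uniform_limit_iff eventually_sequentially by blast
  have "dist (poly_op (p n) P x) (cont_fun_calc f P x) < e" if "n \<ge> N" for n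
  proof -
    have "norm (poly_op (p n) P x - cont_fun_calc f P x) \<le> d * norm x"
      using N[OF that] d(1)
      by (intro cont_fun_calc_works(2)[OF P f]) (auto simp: dist_real_def intro: less_imp_le)
    then show ?thesis
      using d(2) by (simp add: dist_norm)
  qed
  then show "\<exists>N. \<forall>n\<ge>N. dist (poly_op (p n) P x) (cont_fun_calc f P x) < e"
    by blast
qed

text \<open>A nonzero eigenvector puts l into the spectrum, where the approximating polynomials
  converge to f; for e = 0 the number l may lie anywhere, hence the case split.\<close>

lemma cont_fun_calc_eigenvector:
  fixes P :: "'a::chilbert_space \<Rightarrow> 'a"
  assumes P: "pos_compact_op P" and f: "continuous_on {0..} f" and e: "P e = l *\<^sub>R e"
  shows "cont_fun_calc f P e = f l *\<^sub>R e"
proof (cases "e = 0")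
  case True
  then show ?thesis
    using bounded_clinearD(6)[OF cont_fun_calc_works(1)[OF P f]] by simp
next
  case False
  obtain p where p: "uniform_limit {t. complex_of_real t \<in> op_spectrum P} (\<lambda>n t. poly (p n) t) f
      sequentially"
    using ex_poly_uniform_limit_op_spectrum(1)[OF P f] by blast
  have "(\<lambda>n. poly (p n) l) \<longlonglongrightarrow> f l"
    using eigenvalue_in_op_spectrum[of P e l, OF e False] by (intro tendsto_uniform_limitI[OF p]) simp
  then have "(\<lambda>n. poly (p n) l *\<^sub>R e) \<longlonglongrightarrow> f l *\<^sub>R e"
    by (intro tendsto_intros)
  moreover have "(\<lambda>n. poly (p n) l *\<^sub>R e) \<longlonglongrightarrow> cont_fun_calc f P e"
    using poly_op_tendsto_cont_fun_calc[OF P f p, of e]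
    by (simp add: poly_op_eigenvector[OF pos_compact_opD(1)[OF P] e])
  ultimately show ?thesis
    by (metis LIMSEQ_unique)
qed

lemma inner_cont_fun_calc:
  fixes P :: "'a::chilbert_space \<Rightarrow> 'a"
  assumes P: "pos_compact_op P" and f: "continuous_on {0..} f"
  shows "cont_fun_calc f P x \<bullet> y = x \<bullet> cont_fun_calc f P y"
proof -
  obtain p where p: "uniform_limit {t. complex_of_real t \<in> op_spectrum P} (\<lambda>n t. poly (p n) t) f
      sequentially"
    using ex_poly_uniform_limit_op_spectrum(1)[OF P f] by blast
  note lim = poly_op_tendsto_cont_fun_calc[OF P f p]
  have "(\<lambda>n. poly_op (p n) P x \<bullet> y) \<longlonglongrightarrow> cont_fun_calc f P x \<bullet> y"
    by (intro tendsto_intros lim)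
  moreover have "(\<lambda>n. x \<bullet> poly_op (p n) P y) \<longlonglongrightarrow> x \<bullet> cont_fun_calc f P y"
    by (intro tendsto_intros lim)
  ultimately show ?thesis
    unfolding inner_poly_op[OF pos_compact_opD(1,2)[OF P]] by (rule LIMSEQ_unique)
qed

text \<open>If \<open>0 \<le> f \<le> c\<close> on the spectrum, then \<open>\<parallel>c - f(P)\<parallel> \<le> c\<close>, which forces \<open>f(P) \<ge> 0\<close>.\<close>

lemma cont_fun_calc_nonneg:
  fixes P :: "'a::chilbert_space \<Rightarrow> 'a"
  assumes P: "pos_compact_op P" and f: "continuous_on {0..} f" and nonneg: "\<And>t. 0 \<le> f t"
  shows "0 \<le> cont_fun_calc f P x \<bullet> x"
proof -
  obtain c where c: "c > 0" "\<And>t. complex_of_real t \<in> op_spectrum P \<Longrightarrow> f t \<le> c"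
    using ex_poly_uniform_limit_op_spectrum(2)[OF P f] nonneg by (auto simp: bounded_pos)
  have "norm (poly_op [:c:] P x - cont_fun_calc f P x) \<le> c * norm x"
  proof (rule cont_fun_calc_works(2)[OF P f])
    fix t assume "complex_of_real t \<in> op_spectrum P"
    from c(2)[OF this] nonneg[of t] show "\<bar>poly [:c:] t - f t\<bar> \<le> c"
      by simp
  qed (use c(1) in simp)
  then have *: "norm (c *\<^sub>R x - cont_fun_calc f P x) \<le> c * norm x"
    by (simp add: poly_op_def)
  have "(c *\<^sub>R x - cont_fun_calc f P x) \<bullet> x \<le> norm (c *\<^sub>R x - cont_fun_calc f P x) * norm x"
    by (rule norm_cauchy_schwarz)
  also have "\<dots> \<le> (c * norm x) * norm x"
    by (intro mult_right_mono *) auto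
  also have "\<dots> = c * (x \<bullet> x)"
    by (metis mult.assoc power2_eq_square power2_norm_eq_inner)
  finally show ?thesis
    by (simp add: inner_diff_left)
qed

text \<open>Squares of polynomials approximating f approximate the polynomial X on the spectrum,
  which is nonnegative; boundedness of f there allows the uniform limits to be multiplied.\<close>

lemma cont_fun_calc_square:
  fixes P :: "'a::chilbert_space \<Rightarrow> 'a"
  assumes P: "pos_compact_op P" and f: "continuous_on {0..} f" and sq: "\<And>t. 0 \<le> t \<Longrightarrow> f t * f t = t"
  shows "cont_fun_calc f P (cont_fun_calc f P x) = P x"
proof -
  note P' = pos_compact_opD[OF P]
  define \<sigma> where "\<sigma> = {t. complex_of_real t \<in> op_spectrum P}"
  obtain p where p: "uniform_limit \<sigma> (\<lambda>n t. poly (p n) t) f sequentially"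
    using ex_poly_uniform_limit_op_spectrum(1)[OF P f] unfolding \<sigma>_def by blast
  have bdd: "bounded (f ` \<sigma>)"
    using ex_poly_uniform_limit_op_spectrum(2)[OF P f] unfolding \<sigma>_def .
  obtain K where K: "\<And>x. norm (P x) \<le> norm x * K"
    using bounded_linear.bounded[OF bounded_clinearD(1)[OF P'(1)]] by blast
  have "t \<ge> 0" if "t \<in> \<sigma>" for t
    using op_spectrum_bounds(1)[OF P _, of K t] K that by (simp add: \<sigma>_def mult.commute)
  then have "uniform_limit \<sigma> (\<lambda>n t. poly (p n * p n) t) (poly [:0, 1:]) sequentially"
    using uniform_lim_mult[OF p p bdd bdd] sq
    by (simp cong: uniform_limit_cong')
  from poly_op_tendsto[OF P this[unfolded \<sigma>_def], of x]
  have lim_P: "(\<lambda>n. poly_op (p n) P (poly_op (p n) P x)) \<longlonglongrightarrow> P x"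
    by (simp add: poly_op_mult[OF P'(1)] poly_op_pCons[OF P'(1)] bounded_clinearD[OF P'(1)])
  note lim = poly_op_tendsto_cont_fun_calc[OF P f p[unfolded \<sigma>_def]]
  \<comment> \<open>One factor moves across the inner product, so that pointwise convergence at x
    and at y suffices.\<close>
  have "cont_fun_calc f P (cont_fun_calc f P x) \<bullet> y = P x \<bullet> y" for y
  proof -
    have "(\<lambda>n. poly_op (p n) P x \<bullet> poly_op (p n) P y)
        \<longlonglongrightarrow> cont_fun_calc f P x \<bullet> cont_fun_calc f P y"
      by (intro tendsto_intros lim)
    moreover have "(\<lambda>n. poly_op (p n) P (poly_op (p n) P x) \<bullet> y) \<longlonglongrightarrow> P x \<bullet> y"
      by (intro tendsto_intros lim_P)
    ultimately show ?thesis
      by (simp add: inner_poly_op[OF P'(1,2)] inner_cont_fun_calc[OF P f] LIMSEQ_unique)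
  qed
  then show ?thesis
    by (metis vector_eq_rdot)
qed

section \<open>Powers, adjoints and absolute values of compact operators\<close>

text \<open>Passes compactness from a square to its root: where P x_n is Cauchy, the inequality
  applied to differences makes Q x_n Cauchy. It serves Q = |T| with P = T^* T, and Q = T^* with P =
  T T^*.\<close>

lemma seq_compact_op_if_square:
  fixes Q :: "'a::chilbert_space \<Rightarrow> 'a"
  assumes P: "bounded_linear P" "seq_compact_op P" and Q: "bounded_linear Q"
    and sq: "\<And>x. (norm (Q x))\<^sup>2 \<le> norm (P x) * norm x"
  shows "seq_compact_op Q"
  unfolding seq_compact_op_def
proof (intro allI impI)
  fix x :: "nat \<Rightarrow> 'a" assume bdd: "bounded (range x)"
  then obtain r where r: "strict_mono r" "convergent (\<lambda>n. P (x (r n)))"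
    using P(2) unfolding seq_compact_op_def by blast
  obtain K where K: "K > 0" "\<And>n. norm (x n) \<le> K"
    using bdd by (auto simp: bounded_pos)
  have "Cauchy (\<lambda>n. Q (x (r n)))"
  proof (rule metric_CauchyI)
    fix e :: real assume "e > 0"
    have "Cauchy (\<lambda>n. P (x (r n)))"
      by (rule convergent_Cauchy[OF r(2)])
    then obtain N where N: "\<And>m n. m \<ge> N \<Longrightarrow> n \<ge> N
        \<Longrightarrow> norm (P (x (r m)) - P (x (r n))) < e\<^sup>2 / (2 * K)"
      using CauchyD[of _ "e\<^sup>2 / (2 * K)"] K(1) \<open>e > 0\<close> by force
    have "dist (Q (x (r m))) (Q (x (r n))) < e" if "m \<ge> N" "n \<ge> N" for m n
    proof -
      let ?d = "x (r m) - x (r n)"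
      have "norm ?d \<le> 2 * K"
        using norm_triangle_ineq4[of "x (r m)" "x (r n)"] K(2)[of "r m"] K(2)[of "r n"] by linarith
      then have "norm (P ?d) * norm ?d \<le> norm (P ?d) * (2 * K)"
        by (intro mult_left_mono) auto
      also have "\<dots> < e\<^sup>2"
        using N[OF that] K(1) by (simp add: bounded_linear.linear[OF P(1)] linear_diff field_simps)
      finally have "(norm (Q ?d))\<^sup>2 < e\<^sup>2"
        using sq[of ?d] by linarith
      then have "norm (Q ?d) < e"
        using \<open>e > 0\<close> by (intro power2_less_imp_less[of _ e]) auto
      then show ?thesis
        by (simp add: dist_norm bounded_linear.linear[OF Q] linear_diff)
    qed
    then show "\<exists>N. \<forall>m\<ge>N. \<forall>n\<ge>N. dist (Q (x (r m))) (Q (x (r n))) < e"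
      by blast
  qed
  then show "\<exists>r. strict_mono r \<and> convergent (\<lambda>n. Q (x (r n)))"
    using r(1) Cauchy_convergent by blast
qed

lemma continuous_on_powr_convention:
  assumes "0 \<le> r"
  shows "continuous_on {0..} (\<lambda>t::real. if r = 0 then 1 else t powr r)"
proof (cases "r = 0")
  case False
  then show ?thesis
    using assms by simp (intro continuous_on_powr' continuous_on_id continuous_on_const; simp)
qed simp

lemma op_powr_props:
  fixes P :: "'a::chilbert_space \<Rightarrow> 'a"
  assumes P: "pos_compact_op P" and r: "0 \<le> r"
  shows "bounded_clinear (op_powr P r)"
    and "op_powr P r x \<bullet> y = x \<bullet> op_powr P r y"
    and "0 \<le> op_powr P r x \<bullet> x"
    and "P e = l *\<^sub>R e \<Longrightarrow> op_powr P r e = (if r = 0 then 1 else l powr r) *\<^sub>R e"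
  unfolding op_powr_def
  by (rule cont_fun_calc_works[OF P] inner_cont_fun_calc[OF P] cont_fun_calc_nonneg[OF P]
      cont_fun_calc_eigenvector[OF P]; use r continuous_on_powr_convention in simp)+

lemma pos_compact_op_cadjoint_comp:
  fixes T :: "'a::chilbert_space \<Rightarrow> 'b::chilbert_space"
  assumes T: "bounded_clinear T" "seq_compact_op T"
  shows "pos_compact_op (cadjoint T \<circ> T)"
  unfolding pos_compact_op_def
proof (intro conjI allI)
  note adj = inner_cadjoint[OF T(1)]
  have S: "bounded_clinear (cadjoint T)"
    by (rule bounded_clinear_cadjoint[OF T(1)])
  show "bounded_clinear (cadjoint T \<circ> T)"
    using bounded_clinear_compose[OF S T(1)] by (simp add: o_def)
  show "(cadjoint T \<circ> T) x \<bullet> y = x \<bullet> (cadjoint T \<circ> T) y" for x y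
    using adj[of y "T x"] adj[of x "T y"] by (simp add: inner_commute)
  show "0 \<le> (cadjoint T \<circ> T) x \<bullet> x" for x
    using adj[of x "T x"] by (metis comp_apply inner_commute inner_ge_zero)
  show "seq_compact_op (cadjoint T \<circ> T)"
    unfolding seq_compact_op_def
  proof (intro allI impI)
    fix x :: "nat \<Rightarrow> 'a" assume "bounded (range x)"
    then obtain r where r: "strict_mono r" "convergent (\<lambda>n. T (x (r n)))"
      using T(2) unfolding seq_compact_op_def by blast
    obtain L where "(\<lambda>n. T (x (r n))) \<longlonglongrightarrow> L"
      using r(2) by (auto simp: convergent_def)
    then have "(\<lambda>n. (cadjoint T \<circ> T) (x (r n))) \<longlonglongrightarrow> cadjoint T L"
      unfolding comp_apply by (rule bounded_linear.tendsto[OF bounded_clinearD(1)[OF S]])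
    then show "\<exists>r. strict_mono r \<and> convergent (\<lambda>n. (cadjoint T \<circ> T) (x (r n)))"
      using r(1) convergentI by blast
  qed
qed

text \<open>Schauder's theorem in Hilbert space: |T^* x|^2 = <T T^* x, x> reduces it to T T^*, where
  T acts on a bounded sequence.\<close>

lemma seq_compact_op_cadjoint:
  fixes T :: "'a::chilbert_space \<Rightarrow> 'a"
  assumes T: "bounded_clinear T" "seq_compact_op T"
  shows "seq_compact_op (cadjoint T)"
proof (rule seq_compact_op_if_square)
  note S = bounded_clinear_cadjoint[OF T(1)]
  show "bounded_linear (cadjoint T)" and "bounded_linear (\<lambda>x. T (cadjoint T x))"
    using S bounded_clinear_compose[OF T(1) S] by (auto dest: bounded_clinearD(1))
  show "seq_compact_op (\<lambda>x. T (cadjoint T x))"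
    unfolding seq_compact_op_def
  proof (intro allI impI)
    fix x :: "nat \<Rightarrow> 'a" assume "bounded (range x)"
    then have "bounded (range (\<lambda>n. cadjoint T (x n)))"
      using bounded_linear_image[OF _ bounded_clinearD(1)[OF S]] by (metis image_image)
    then show "\<exists>r. strict_mono r \<and> convergent (\<lambda>n. T (cadjoint T (x (r n))))"
      using T(2) unfolding seq_compact_op_def by blast
  qed
  show "(norm (cadjoint T x))\<^sup>2 \<le> norm (T (cadjoint T x)) * norm x" for x
    using norm_cauchy_schwarz[of "T (cadjoint T x)" x]
    by (simp add: inner_cadjoint[OF T(1)] power2_norm_eq_inner)
qed

text \<open>Compactness and the norm identity rest on |T|^2 = T^* T. The last clause later evaluates
  |A^*| at the left singular vectors of A, where only the action of A A^* is known.\<close>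

lemma op_abs_props:
  fixes T :: "'a::chilbert_space \<Rightarrow> 'a"
  assumes T: "bounded_clinear T" "seq_compact_op T"
  shows "pos_compact_op (op_abs T)"
    and "op_abs T (op_abs T x) = cadjoint T (T x)"
    and "norm (op_abs T x) = norm (T x)"
    and "0 \<le> l \<Longrightarrow> cadjoint T (T e) = l\<^sup>2 *\<^sub>R e \<Longrightarrow> op_abs T e = l *\<^sub>R e"
proof -
  note P = pos_compact_op_cadjoint_comp[OF T]
  note R = op_powr_props[OF P, of "1 / 2", simplified, folded op_abs_def]
  show sq: "op_abs T (op_abs T x) = cadjoint T (T x)" for x
    using cont_fun_calc_square[OF P continuous_on_powr_convention[of "1 / 2"]]
    by (simp add: op_abs_def op_powr_def flip: powr_add)
  have norm: "(norm (op_abs T x))\<^sup>2 = x \<bullet> cadjoint T (T x)" for x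
    by (simp add: power2_norm_eq_inner R(2) sq)
  show "norm (op_abs T x) = norm (T x)" for x
    using norm[of x] by (simp add: norm_eq_sqrt_inner inner_cadjoint[OF T(1)] power2_norm_eq_inner)
  have "seq_compact_op (op_abs T)"
  proof (rule seq_compact_op_if_square)
    show "(norm (op_abs T x))\<^sup>2 \<le> norm ((cadjoint T \<circ> T) x) * norm x" for x
      using norm_cauchy_schwarz[of "cadjoint T (T x)" x] by (simp add: norm inner_commute)
  qed (rule bounded_clinearD(1)[OF pos_compact_opD(1)[OF P]] pos_compact_opD(5)[OF P]
      bounded_clinearD(1)[OF R(1)])+
  then show "pos_compact_op (op_abs T)"
    using R(1-3) by (simp add: pos_compact_op_def)
  show "op_abs T e = l *\<^sub>R e" if "0 \<le> l" "cadjoint T (T e) = l\<^sup>2 *\<^sub>R e"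
    using R(4)[of e "l\<^sup>2"] that by (simp add: powr_half_sqrt)
qed

section \<open>The eigenvalue sequence\<close>

text \<open>The eigenvalue counting function in abstract form. The condition \<open>0 < m c\<close>
  keeps the index set finite, as sums over infinite sets are 0 by convention.\<close>

definition count_above :: "(real \<Rightarrow> nat) \<Rightarrow> real \<Rightarrow> nat" where
  "count_above m t = (\<Sum>c | t < c \<and> 0 < m c. m c)"

text \<open>The body of the description in \<open>eigenvalue_seq\<close> with eigenspace dimensions
  abstracted to a function, so that existence and uniqueness concern only decreasing real
  sequences.\<close>

definition enumerates_multiplicities :: "(real \<Rightarrow> nat) \<Rightarrow> (nat \<Rightarrow> real) \<Rightarrow> bool" where
  "enumerates_multiplicities m s \<longleftrightarrow> decseq s \<and> (\<forall>n. 0 \<le> s n) \<and>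
    (\<forall>c>0. finite {n. s n = c} \<and> card {n. s n = c} = m c)"

context
  fixes m :: "real \<Rightarrow> nat"
  assumes finite_above: "\<And>t. 0 < t \<Longrightarrow> finite {c. t < c \<and> 0 < m c}"
begin

text \<open>By monotonicity the indices with value above t form an initial segment, and adding up
  multiplicities gives its length. The equivalence determines a nonnegative sequence
  completely.\<close>

lemma enumerates_greater_iff:
  assumes s: "enumerates_multiplicities m s" and t: "0 < t"
  shows "t < s n \<longleftrightarrow> n < count_above m t"
proof -
  define S where "S = {n. t < s n}"
  have dec: "\<And>i k. i \<le> k \<Longrightarrow> s k \<le> s i"
    and mult: "\<And>c. c > 0 \<Longrightarrow> finite {n. s n = c} \<and> card {n. s n = c} = m c"
    using s by (auto simp: enumerates_multiplicities_def decseq_def)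
  have "0 < m (s n)" if "t < s n" for n
  proof -
    have "finite {k. s k = s n}" "card {k. s k = s n} = m (s n)"
      using mult[of "s n"] that t by auto
    then show ?thesis
      by (metis (mono_tags) card_gt_0_iff empty_iff mem_Collect_eq)
  qed
  then have S: "S = (\<Union>c\<in>{c. t < c \<and> 0 < m c}. {n. s n = c})"
    by (auto simp: S_def)
  have "finite S"
    unfolding S using finite_above[OF t] mult t by (intro finite_UN_I) auto
  have "card S = (\<Sum>c | t < c \<and> 0 < m c. card {n. s n = c})"
    unfolding S using finite_above[OF t] mult t by (intro card_UN_disjoint) auto
  also have "\<dots> = count_above m t"
    unfolding count_above_def using mult t by (intro sum.cong) auto
  finally have card: "card S = count_above m t" .
  show ?thesis
  proof
    assume "t < s n"
    then have "{..n} \<subseteq> S"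
      using dec by (force simp: S_def)
    from card_mono[OF \<open>finite S\<close> this] show "n < count_above m t"
      by (simp add: card)
  next
    assume n: "n < count_above m t"
    show "t < s n"
    proof (rule ccontr)
      assume "\<not> t < s n"
      have "S \<subseteq> {..<n}"
      proof
        fix k assume "k \<in> S"
        then show "k \<in> {..<n}"
          using dec[of n k] \<open>\<not> t < s n\<close> by (cases "n \<le> k") (auto simp: S_def)
      qed
      then have "card S \<le> n"
        using card_mono[of "{..<n}" S] by simp
      then show False
        using n card by simp
    qed
  qed
qed

lemma enumerates_unique:
  assumes "enumerates_multiplicities m s" "enumerates_multiplicities m s'"
  shows "s = s'"
proof (rule ext, rule antisym)
  have "u n \<le> v n" if "enumerates_multiplicities m u" "enumerates_multiplicities m v" for u v n
  proof (rule ccontr)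
    assume "\<not> u n \<le> v n"
    then obtain t where t: "v n < t" "t < u n"
      using dense not_le by metis
    moreover have "0 \<le> v n"
      using that by (simp add: enumerates_multiplicities_def)
    ultimately have "0 < t"
      by linarith
    then show False
      using enumerates_greater_iff[OF that(1), of t n] enumerates_greater_iff[OF that(2), of t n] t
      by linarith
  qed
  then show "s n \<le> s' n" "s' n \<le> s n" for n
    using assms by blast+
qed

lemma count_above_antimono:
  assumes "0 < t" "t \<le> u"
  shows "count_above m u \<le> count_above m t"
  unfolding count_above_def using finite_above[OF assms(1)] assms(2)
  by (intro sum_mono2) auto

text \<open>The witness is the generalised inverse of the counting function: the n-th entry is the
  infimum of the positive thresholds with at most n values above them.\<close>

lemma ex_enumerates: "\<exists>s. enumerates_multiplicities m s"
proof -
  define A where "A n = {t. 0 < t \<and> count_above m t \<le> n}" for n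
  define s where "s n = Inf (A n)" for n
  have bdd: "bdd_below (A n)" for n
    by (rule bdd_belowI[of _ 0]) (simp add: A_def)
  have ne: "A n \<noteq> {}" for n
  proof -
    define t where "t = Max (insert 1 {c. 1 < c \<and> 0 < m c})"
    have fin: "finite (insert 1 {c. 1 < c \<and> 0 < m c})"
      using finite_above[of 1] by simp
    have "t \<ge> 1"
      unfolding t_def using fin by (intro Max_ge) auto
    moreover have "c \<le> t" if "1 < c" "0 < m c" for c
      unfolding t_def using fin that by (intro Max_ge) auto
    ultimately have "{c. t < c \<and> 0 < m c} = {}"
      by force
    then have "count_above m t = 0"
      unfolding count_above_def by simp
    then show ?thesis
      using \<open>t \<ge> 1\<close> by (auto simp: A_def intro!: exI[of _ t])
  qed
  have greater_iff: "t < s n \<longleftrightarrow> n < count_above m t" if "0 < t" for t n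
  proof
    assume "t < s n"
    show "n < count_above m t"
    proof (rule ccontr)
      assume "\<not> n < count_above m t"
      then have "t \<in> A n"
        using that by (simp add: A_def)
      then have "s n \<le> t"
        unfolding s_def using bdd by (rule cInf_lower)
      then show False
        using \<open>t < s n\<close> by simp
    qed
  next
    assume n: "n < count_above m t"
    define C where "C = {c. t < c \<and> 0 < m c}"
    have "finite C"
      unfolding C_def by (rule finite_above[OF that])
    have "C \<noteq> {}"
    proof
      assume "C = {}"
      then have "count_above m t = 0"
        unfolding count_above_def C_def[symmetric] by simp
      then show False
        using n by simp
    qed
    \<comment> \<open>No value lies between t and \<open>Min C\<close>, so the counts at u and t
      agree and every threshold in \<open>A n\<close> is at least u. This keeps the infimum strictly
      above t.\<close>
    define u where "u = (t + Min C) / 2"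
    have "Min C \<in> C"
      using \<open>finite C\<close> \<open>C \<noteq> {}\<close> by (rule Min_in)
    then have u: "t < u" "u < Min C"
      by (auto simp: C_def u_def)
    have "{c. u < c \<and> 0 < m c} = C"
    proof (intro set_eqI iffI)
      fix c assume "c \<in> C"
      then show "c \<in> {c. u < c \<and> 0 < m c}"
        using u Min_le[OF \<open>finite C\<close>, of c] by (auto simp: C_def)
    qed (use u in \<open>auto simp: C_def\<close>)
    then have "count_above m u = count_above m t"
      by (simp add: count_above_def C_def)
    have "u \<le> v" if "v \<in> A n" for v
    proof (rule ccontr)
      assume "\<not> u \<le> v"
      then have "count_above m u \<le> count_above m v"
        using that by (intro count_above_antimono) (auto simp: A_def)
      then show False
        using that n \<open>count_above m u = count_above m t\<close> by (simp add: A_def)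
    qed
    then have "u \<le> s n"
      unfolding s_def by (rule cInf_greatest[OF ne])
    then show "t < s n"
      using u(1) by simp
  qed
  have "decseq s"
    unfolding s_def decseq_def using bdd ne
    by (intro allI impI cInf_superset_mono) (auto simp: A_def)
  moreover have "0 \<le> s n" for n
    unfolding s_def by (rule cInf_greatest[OF ne]) (simp add: A_def)
  moreover have "finite {n. s n = c} \<and> card {n. s n = c} = m c" if "0 < c" for c
  proof -
    \<comment> \<open>\<open>Max D\<close> is the largest value between c/2 and c, or c/2 if there
      is none. From there up to c the count is constant, \<open>m c\<close> plus the count above
      c.\<close>
    define D where "D = insert (c / 2) {x. (c / 2 < x \<and> 0 < m x) \<and> x < c}"
    define u where "u = Max D"
    have "D \<subseteq> insert (c / 2) {x. c / 2 < x \<and> 0 < m x}"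
      by (auto simp: D_def)
    then have "finite D"
      by (rule finite_subset) (use finite_above[of "c / 2"] that in simp)
    moreover have "D \<noteq> {}"
      by (simp add: D_def)
    ultimately have "u \<in> D" and u_ge: "\<And>x. x \<in> D \<Longrightarrow> x \<le> u"
      unfolding u_def by (auto intro: Max_in Max_ge)
    then have u: "0 < u" "u < c"
      using that by (auto simp: D_def)
    have gap: "m x = 0" if "u < x" "x < c" for x
    proof (rule ccontr)
      assume "m x \<noteq> 0"
      moreover have "c / 2 < x"
        using u_ge[of "c / 2"] that(1) by (simp add: D_def)
      ultimately show False
        using u_ge[of x] that by (simp add: D_def)
    qed
    have count: "count_above m w = m c + count_above m c" if "u \<le> w" "w < c" for w
    proof (cases "m c = 0")
      case True
      then have "{x. w < x \<and> 0 < m x} = {x. c < x \<and> 0 < m x}"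
        using gap that
          by (metis (no_types, lifting) less_irrefl linorder_less_linear order.strict_trans
              order_le_less_trans)
      then show ?thesis
        using True by (simp add: count_above_def)
    next
      case False
      then have "{x. w < x \<and> 0 < m x} = insert c {x. c < x \<and> 0 < m x}"
        using gap that by (auto simp: not_less intro: ccontr)
      then show ?thesis
        using finite_above[OF \<open>0 < c\<close>] by (simp add: count_above_def)
    qed
    have "{n. s n = c} = {count_above m c..<count_above m c + m c}"
    proof (intro set_eqI iffI)
      fix n assume "n \<in> {n. s n = c}"
      then have "u < s n" "\<not> c < s n"
        using u by auto
      then show "n \<in> {count_above m c..<count_above m c + m c}"
        using greater_iff u that count[of u] by auto
    next
      fix n assume n: "n \<in> {count_above m c..<count_above m c + m c}"
      have "w < s n" if "u \<le> w" "w < c" for w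
        using greater_iff[of w n] count[OF that] n that u by simp
      then have "c \<le> s n"
        using u dense_ge[of c "s n"] by (meson dense leI less_asym less_imp_le order_less_trans)
      moreover have "s n \<le> c"
        using greater_iff[OF that, of n] n by auto
      ultimately show "n \<in> {n. s n = c}"
        by simp
    qed
    then show ?thesis
      by simp
  qed
  ultimately show ?thesis
    unfolding enumerates_multiplicities_def by blast
qed

end

section \<open>Eigenspace dimensions and the eigenvalue sequence\<close>

lemma corthonormal_independent:
  fixes E :: "'a::complex_inner set"
  assumes "finite E" "corthonormal (\<lambda>e. e) E"
  shows "complex_vector.independent E"
proof -
  have "u v = 0" if "(\<Sum>e\<in>E. u e *\<^sub>C e) = 0" "v \<in> E" for u v
    using cinner_sum_corthonormal[OF assms that(2), of u] that(1) by simp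
  then show ?thesis
    using complex_vector.dependent_finite[OF assms(1)] by blast
qed

text \<open>An eigenvector for c is orthogonal to the basis vectors with other eigenvalues.
  Subtracting its projection leaves a vector orthogonal to E that P multiplies by c > t, which the
  bound t on the complement allows only for 0.\<close>

lemma eigenbasis_above_cdim_eigenspace:
  fixes P :: "'a::complex_inner \<Rightarrow> 'a"
  assumes P: "pos_compact_op P" and E: "eigenbasis_above P t E" and c: "t < c"
  shows "cdim {x. P x = complex_of_real c *\<^sub>C x} = card {e \<in> E. P e = c *\<^sub>R e}"
proof (rule complex_vector.dim_unique)
  note P' = pos_compact_opD[OF P]
  note lin = bounded_clinearD[OF P'(1)]
  let ?E = "{e \<in> E. P e = c *\<^sub>R e}"
  have fin: "finite E" and on: "corthonormal (\<lambda>e. e) E"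
    and ev: "\<And>e. e \<in> E \<Longrightarrow> \<exists>l>t. P e = l *\<^sub>R e"
    and small: "\<And>x. (\<And>e. e \<in> E \<Longrightarrow> cinner x e = 0) \<Longrightarrow> norm (P x) \<le> t * norm x"
    using E by (auto simp: eigenbasis_above_def)
  show "?E \<subseteq> {x. P x = complex_of_real c *\<^sub>C x}"
    by (auto simp: scaleC_of_real)
  show "complex_vector.independent ?E"
    using on fin by (intro corthonormal_independent) (auto simp: corthonormal_def)
  show "{x. P x = complex_of_real c *\<^sub>C x} \<subseteq> cspan ?E"
  proof
    fix x assume "x \<in> {x. P x = complex_of_real c *\<^sub>C x}"
    then have Px: "P x = c *\<^sub>R x"
      by (simp add: scaleC_of_real)
    have zero: "cinner x e = 0" if "e \<in> E" "P e \<noteq> c *\<^sub>R e" for e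
    proof -
      obtain l where l: "P e = l *\<^sub>R e"
        using ev[OF \<open>e \<in> E\<close>] by blast
      have "of_real c * cinner x e = of_real l * cinner x e"
        using P'(3)[of x e] unfolding Px l
        by (metis cinner_scaleC_right cinner_scaleR_left complex_cnj_complex_of_real scaleC_of_real)
      then show ?thesis
        using that(2) l by auto
    qed
    define z where "z = (\<Sum>e\<in>?E. cinner x e *\<^sub>C e)"
    have z: "z = (\<Sum>e\<in>E. cinner x e *\<^sub>C e)"
      unfolding z_def using fin zero
      by (intro sum.mono_neutral_left) auto
    have "P z = (\<Sum>e\<in>?E. c *\<^sub>R (cinner x e *\<^sub>C e))"
      unfolding z_def lin
      by (intro sum.cong)
        (auto simp: lin scaleC_scaleC mult.commute simp flip: scaleC_of_real)
    then have "P z = c *\<^sub>R z"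
      by (simp add: z_def scaleR_sum_right)
    then have "P (x - z) = c *\<^sub>R (x - z)"
      by (simp add: lin Px scaleR_diff_right)
    moreover have "norm (P (x - z)) \<le> t * norm (x - z)"
      by (rule small) (simp add: z corthonormal_residual[OF fin on])
    ultimately have "\<bar>c\<bar> * norm (x - z) \<le> t * norm (x - z)"
      by simp
    then have "x = z"
      using c by (auto simp: mult_le_cancel_right)
    then show "x \<in> cspan ?E"
      unfolding z_def
      by (metis (no_types, lifting) complex_vector.span_base complex_vector.span_scale
          complex_vector.span_sum)
  qed
qed simp

lemma eigenbasis_above_count:
  fixes P :: "'a::complex_inner \<Rightarrow> 'a"
  defines "m \<equiv> \<lambda>c. cdim {x. P x = complex_of_real c *\<^sub>C x}"
  assumes P: "pos_compact_op P" and E: "eigenbasis_above P t E"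
  shows "finite {c. t < c \<and> 0 < m c}" and "count_above m t = card E"
proof -
  have fin: "finite E" and on: "corthonormal (\<lambda>e. e) E"
    using E by (auto simp: eigenbasis_above_def)
  obtain l where l: "\<And>e. e \<in> E \<Longrightarrow> t < l e" "\<And>e. e \<in> E \<Longrightarrow> P e = l e *\<^sub>R e"
    using E unfolding eigenbasis_above_def by metis
  have "e \<noteq> 0" if "e \<in> E" for e
    using on that unfolding corthonormal_def by (metis cinner_zero_left zero_neq_one)
  then have "{e \<in> E. P e = c *\<^sub>R e} = {e \<in> E. l e = c}" for c
    using l(2) by auto
  then have m: "m c = card {e \<in> E. l e = c}" if "t < c" for c
    using eigenbasis_above_cdim_eigenspace[OF P E that] by (simp add: m_def)
  then have eq: "{c. t < c \<and> 0 < m c} = l ` E"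
    using l(1) fin by (auto simp: card_gt_0_iff)
  then show "finite {c. t < c \<and> 0 < m c}"
    using fin by simp
  have "card E = (\<Sum>c\<in>l ` E. card {e \<in> E. l e = c})"
    using sum.image_gen[OF fin, of "\<lambda>_. 1::nat" l] by simp
  also have "\<dots> = (\<Sum>c\<in>l ` E. m c)"
    using m l(1) by (intro sum.cong) auto
  finally show "count_above m t = card E"
    by (simp add: count_above_def eq)
qed

text \<open>The interface through which \<open>eigenvalue_seq\<close> is used: comparing an entry
  with t becomes comparing its index, counted from 0, with the size of an eigenbasis.\<close>

lemma eigenvalue_seq_props:
  fixes P :: "'a::complex_inner \<Rightarrow> 'a"
  assumes P: "pos_compact_op P"
  shows "0 \<le> eigenvalue_seq P n"
    and "0 < t \<Longrightarrow> eigenbasis_above P t E \<Longrightarrow> t < eigenvalue_seq P n \<longleftrightarrow> n < card E"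
proof -
  define m where "m = (\<lambda>c. cdim {x. P x = complex_of_real c *\<^sub>C x})"
  have fin: "finite {c. t < c \<and> 0 < m c}" if "0 < t" for t
    using ex_eigenbasis_above[OF P that] eigenbasis_above_count(1)[OF P] unfolding m_def by blast
  have "eigenvalue_seq P = (THE s. enumerates_multiplicities m s)"
    by (simp add: eigenvalue_seq_def enumerates_multiplicities_def m_def)
  moreover have "\<exists>!s. enumerates_multiplicities m s"
    using ex_enumerates[OF fin] enumerates_unique[OF fin] by blast
  ultimately have s: "enumerates_multiplicities m (eigenvalue_seq P)"
    by (metis theI')
  then show "0 \<le> eigenvalue_seq P n"
    by (simp add: enumerates_multiplicities_def)
  show "t < eigenvalue_seq P n \<longleftrightarrow> n < card E" if "0 < t" "eigenbasis_above P t E"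
    using enumerates_greater_iff[OF fin s that(1)] eigenbasis_above_count(2)[OF P that(2)]
    by (simp add: m_def)
qed

section \<open>The mixed Schwarz inequality\<close>

lemma norm_corthonormal_residual_le:
  assumes "finite I" "corthonormal f I"
  shows "norm (x - (\<Sum>i\<in>I. cinner x (f i) *\<^sub>C f i)) \<le> norm x"
proof -
  define z where "z = (\<Sum>i\<in>I. cinner x (f i) *\<^sub>C f i)"
  have "z \<bullet> (x - z) = 0"
    using cinner_sum_residual[OF assms, of "\<lambda>i. cinner x (f i)" x]
    by (simp add: z_def flip: Re_cinner)
  then have "(norm (x - z))\<^sup>2 = (norm x)\<^sup>2 - (norm z)\<^sup>2"
    unfolding power2_norm_eq_inner by (simp add: algebra_simps inner_commute)
  then have "(norm (x - z))\<^sup>2 \<le> (norm x)\<^sup>2"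
    by simp
  then show ?thesis
    unfolding z_def by (rule power2_le_imp_le) simp
qed

text \<open>A weighted Bessel inequality. With z the projection of x, \<open>Q z\<close> stays in
  the span, so the cross term vanishes and the residual only adds the nonnegative
  \<open>Q (x - z) \<bullet> (x - z)\<close>.\<close>

lemma sum_eigenvalues_le_inner:
  assumes Q: "bounded_clinear Q" "\<And>x y. Q x \<bullet> y = x \<bullet> Q y" "\<And>x. 0 \<le> Q x \<bullet> x"
    and I: "finite I" "corthonormal f I" and ev: "\<And>i. i \<in> I \<Longrightarrow> Q (f i) = l i *\<^sub>R f i"
  shows "(\<Sum>i\<in>I. l i * (cmod (cinner x (f i)))\<^sup>2) \<le> Q x \<bullet> x"
proof -
  note lin = bounded_clinearD[OF Q(1)]
  define z where "z = (\<Sum>i\<in>I. cinner x (f i) *\<^sub>C f i)"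
  have Qz: "Q z = (\<Sum>i\<in>I. (cinner x (f i) * l i) *\<^sub>C f i)"
    unfolding z_def lin using ev
    by (intro sum.cong) (auto simp: lin scaleC_scaleC simp flip: scaleC_of_real)
  have "cinner (Q z) (x - z) = 0"
    unfolding Qz unfolding z_def by (rule cinner_sum_residual[OF I])
  then have "Q z \<bullet> (x - z) = 0"
    by (simp flip: Re_cinner)
  moreover have "Q x \<bullet> x = Q z \<bullet> z + 2 * (Q z \<bullet> (x - z)) + Q (x - z) \<bullet> (x - z)"
    using Q(2)[of x z] by (simp add: lin algebra_simps inner_commute)
  ultimately have "Q z \<bullet> z \<le> Q x \<bullet> x"
    using Q(3)[of "x - z"] by linarith
  moreover have "Q z \<bullet> z = (\<Sum>i\<in>I. l i * (cmod (cinner x (f i)))\<^sup>2)"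
  proof -
    have "cinner (Q z) z = (\<Sum>i\<in>I. (cinner x (f i) * l i) * cnj (cinner x (f i)))"
      unfolding Qz by (simp add: z_def cinner_sum_sum_corthonormal[OF I])
    also have "\<dots> = of_real (\<Sum>i\<in>I. l i * (cmod (cinner x (f i)))\<^sup>2)"
      unfolding of_real_sum of_real_mult complex_norm_square by (simp add: mult_ac)
    finally show ?thesis
      by (simp flip: Re_cinner)
  qed
  ultimately show ?thesis
    by simp
qed

text \<open>A truncated singular value decomposition: the left singular vectors are T e / l e,
  orthonormal because T^* T e = (l e)^2 e.\<close>

lemma eigenbasis_above_singular_vectors:
  fixes T :: "'a::chilbert_space \<Rightarrow> 'a"
  assumes T: "bounded_clinear T" "seq_compact_op T" and "0 < t"
    and E: "eigenbasis_above (op_abs T) t E"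
  obtains l f where "\<And>e. e \<in> E \<Longrightarrow> t < l e" "\<And>e. e \<in> E \<Longrightarrow> op_abs T e = l e *\<^sub>R e"
    "corthonormal f E" "\<And>e. e \<in> E \<Longrightarrow> T e = l e *\<^sub>R f e"
    "\<And>e. e \<in> E \<Longrightarrow> T (cadjoint T (f e)) = (l e)\<^sup>2 *\<^sub>R f e"
proof -
  note lin = bounded_clinearD[OF T(1)]
  note R = op_abs_props[OF T]
  note lin_R = bounded_clinearD[OF pos_compact_opD(1)[OF R(1)]]
  note lin_adj = bounded_clinearD[OF bounded_clinear_cadjoint[OF T(1)]]
  obtain l where l: "\<And>e. e \<in> E \<Longrightarrow> t < l e" "\<And>e. e \<in> E \<Longrightarrow> op_abs T e = l e *\<^sub>R e"
    using E unfolding eigenbasis_above_def by metis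
  have l_pos: "0 < l e" if "e \<in> E" for e
    using l(1)[OF that] \<open>0 < t\<close> by simp
  have sq: "cadjoint T (T e) = (l e)\<^sup>2 *\<^sub>R e" if "e \<in> E" for e
    using R(2)[of e] l(2)[OF that] by (simp add: lin_R power2_eq_square)
  define f where "f e = (1 / l e) *\<^sub>R T e" for e
  have "cinner (f e) (f e') = (if e = e' then 1 else 0)" if "e \<in> E" "e' \<in> E" for e e'
  proof -
    have "cinner (f e) (f e') = of_real (1 / l e) * cinner (T e) (f e')"
      by (simp add: f_def cinner_scaleR_left)
    also have "cinner (T e) (f e') = cinner e (cadjoint T (f e'))"
      by (rule cadjoint_works[OF T(1)])
    also have "cadjoint T (f e') = complex_of_real (l e') *\<^sub>C e'"
      using l_pos[OF that(2)] by (simp add: f_def lin_adj sq[OF that(2)] power2_eq_square scaleC_of_real)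
    also have "cinner e (complex_of_real (l e') *\<^sub>C e') = of_real (l e') * (if e = e' then 1 else 0)"
      using E that by (simp add: cinner_scaleC_right eigenbasis_above_def corthonormal_def)
    finally show ?thesis
      using l_pos[OF that(1)] by auto
  qed
  then have "corthonormal f E"
    by (simp add: corthonormal_def)
  moreover have "T e = l e *\<^sub>R f e" if "e \<in> E" for e
    using l_pos[OF that] by (simp add: f_def)
  moreover have "T (cadjoint T (f e)) = (l e)\<^sup>2 *\<^sub>R f e" if "e \<in> E" for e
    using l_pos[OF that] by (simp add: f_def lin lin_adj sq[OF that])
  ultimately show ?thesis
    using that l by blast
qed

text \<open>Only singular values above t are expanded; A maps the tail of y to norm at most t |y|,
  which \<epsilon> absorbs. In the finite part \<open>sum_eigenvalues_le_inner\<close> bounds the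
  two sums produced by the arithmetic-geometric mean.\<close>

lemma mixed_Schwarz:
  fixes A :: "'a::chilbert_space \<Rightarrow> 'a"
  assumes A: "bounded_clinear A" "seq_compact_op A" and \<alpha>: "0 \<le> \<alpha>" "\<alpha> \<le> 1"
  shows "2 * (A y \<bullet> x) \<le> op_powr (op_abs A) (2 * \<alpha>) y \<bullet> y
    + op_powr (op_abs (cadjoint A)) (2 * (1 - \<alpha>)) x \<bullet> x"
    (is "_ \<le> ?q y \<bullet> y + ?p x \<bullet> x")
proof (rule field_le_epsilon)
  fix \<epsilon> :: real assume "\<epsilon> > 0"
  define t where "t = \<epsilon> / (2 * (norm y * norm x) + 1)"
  have "2 * (norm y * norm x) + 1 > 0"
    by (simp add: add_nonneg_pos)
  then have t: "0 < t" "2 * (t * norm y * norm x) \<le> \<epsilon>"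
    using \<open>\<epsilon> > 0\<close> by (auto simp: t_def field_simps)
  note lin = bounded_clinearD[OF A(1)]
  note R = op_abs_props[OF A]
  note R' = op_abs_props[OF bounded_clinear_cadjoint[OF A(1)] seq_compact_op_cadjoint[OF A]]
  obtain E where E: "eigenbasis_above (op_abs A) t E"
    using ex_eigenbasis_above[OF R(1) t(1)] by blast
  obtain l f where l: "\<And>e. e \<in> E \<Longrightarrow> t < l e" "\<And>e. e \<in> E \<Longrightarrow> op_abs A e = l e *\<^sub>R e"
    and f: "corthonormal f E" "\<And>e. e \<in> E \<Longrightarrow> A e = l e *\<^sub>R f e"
      "\<And>e. e \<in> E \<Longrightarrow> A (cadjoint A (f e)) = (l e)\<^sup>2 *\<^sub>R f e"
    using eigenbasis_above_singular_vectors[OF A t(1) E] by metis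
  have fin: "finite E" and on: "corthonormal (\<lambda>e. e) E"
    using E by (auto simp: eigenbasis_above_def)
  have l_pos: "0 < l e" if "e \<in> E" for e
    using l(1)[OF that] t(1) by simp
  have Rf: "op_abs (cadjoint A) (f e) = l e *\<^sub>R f e" if "e \<in> E" for e
    using l_pos[OF that] f(3)[OF that] by (intro R'(4)) (simp_all add: cadjoint_cadjoint[OF A(1)])
  have "0 \<le> 2 * \<alpha>" "0 \<le> 2 * (1 - \<alpha>)"
    using \<alpha> by auto
  note q = op_powr_props[OF R(1) this(1)] and p = op_powr_props[OF R'(1) this(2)]
  \<comment> \<open>Since \<open>l e\<close> is positive, its power with exponent 0 is 1, in
    agreement with the convention in \<open>op_powr\<close>; the endpoints \<alpha> = 0 and \<alpha>
    = 1 thus need no case of their own.\<close>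
  have q_ev: "?q e = l e powr (2 * \<alpha>) *\<^sub>R e" if "e \<in> E" for e
    using q(4)[OF l(2)[OF that]] l_pos[OF that] by simp
  have p_ev: "?p (f e) = l e powr (2 * (1 - \<alpha>)) *\<^sub>R f e" if "e \<in> E" for e
    using p(4)[OF Rf[OF that]] l_pos[OF that] by simp
  define a b where "a e = cmod (cinner y e)" and "b e = cmod (cinner x (f e))" for e
  \<comment> \<open>The weight splits as l = l^\<alpha> l^(1 - \<alpha>), one factor going with each
    coefficient.\<close>
  have AMGM: "2 * (l e * (a e * b e))
      \<le> l e powr (2 * \<alpha>) * (a e)\<^sup>2 + l e powr (2 * (1 - \<alpha>)) * (b e)\<^sup>2" if "e \<in> E" for e
  proof -
    have "l e powr (2 * \<alpha>) = (l e powr \<alpha>)\<^sup>2" "l e powr (2 * (1 - \<alpha>)) = (l e powr (1 - \<alpha>))\<^sup>2"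
      by (simp_all add: power2_eq_square flip: powr_add)
    moreover have "l e powr \<alpha> * l e powr (1 - \<alpha>) = l e"
      using l_pos[OF that] by (simp flip: powr_add)
    moreover have "0 \<le> (l e powr \<alpha> * a e - l e powr (1 - \<alpha>) * b e)\<^sup>2"
      by simp
    ultimately show ?thesis
      by (simp add: power2_diff power_mult_distrib mult_ac)
  qed
  define z where "z = (\<Sum>e\<in>E. cinner y e *\<^sub>C e)"
  have "A z = (\<Sum>e\<in>E. (cinner y e * l e) *\<^sub>C f e)"
    unfolding z_def lin using f(2)
    by (intro sum.cong) (auto simp: lin scaleC_scaleC simp flip: scaleC_of_real)
  then have "A z \<bullet> x = Re (\<Sum>e\<in>E. cinner y e * l e * cinner (f e) x)"
    by (simp only: Re_cinner[symmetric] cinner_sum_left cinner_scaleC_left)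
  also have "\<dots> \<le> cmod (\<Sum>e\<in>E. cinner y e * l e * cinner (f e) x)"
    by (rule complex_Re_le_cmod)
  also have "\<dots> \<le> (\<Sum>e\<in>E. cmod (cinner y e * l e * cinner (f e) x))"
    by (rule norm_sum)
  also have "\<dots> = (\<Sum>e\<in>E. l e * (a e * b e))"
    using l_pos
    by (intro sum.cong) (auto simp: a_def b_def norm_mult norm_cinner_commute[of _ x] less_imp_le)
  finally have "2 * (A z \<bullet> x) \<le> (\<Sum>e\<in>E. 2 * (l e * (a e * b e)))"
    by (simp flip: sum_distrib_left)
  also have "\<dots> \<le> (\<Sum>e\<in>E. l e powr (2 * \<alpha>) * (a e)\<^sup>2 + l e powr (2 * (1 - \<alpha>)) * (b e)\<^sup>2)"
    by (rule sum_mono) (rule AMGM)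
  also have "\<dots> \<le> ?q y \<bullet> y + ?p x \<bullet> x"
    unfolding sum.distrib a_def b_def
    using sum_eigenvalues_le_inner[OF q(1-3) fin on q_ev, of y]
      sum_eigenvalues_le_inner[OF p(1-3) fin f(1) p_ev, of x]
    by (rule add_mono)
  finally have large: "2 * (A z \<bullet> x) \<le> ?q y \<bullet> y + ?p x \<bullet> x" .
  have "norm (op_abs A (y - z)) \<le> t * norm (y - z)"
    using E corthonormal_residual[OF fin on, of _ y] unfolding eigenbasis_above_def z_def by blast
  also have "\<dots> \<le> t * norm y"
    using norm_corthonormal_residual_le[OF fin on, of y] t(1) by (simp add: z_def)
  finally have "norm (A (y - z)) * norm x \<le> t * norm y * norm x"
    unfolding R(3) by (rule mult_right_mono) simp
  then have "A (y - z) \<bullet> x \<le> t * norm y * norm x"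
    using norm_cauchy_schwarz[of "A (y - z)" x] by linarith
  moreover have "A y \<bullet> x = A z \<bullet> x + A (y - z) \<bullet> x"
    by (simp add: lin inner_diff_left)
  ultimately show "2 * (A y \<bullet> x) \<le> ?q y \<bullet> y + ?p x \<bullet> x + \<epsilon>"
    using large t(2) by linarith
qed

section \<open>Singular values and quadratic forms\<close>

text \<open>A space of dimension below n cannot hold n independent images. Only a nonzero
  coefficient is asserted; that the combination itself is nonzero is left to the
  application.\<close>

lemma ex_combination_in_kernel:
  fixes F :: "'b::complex_inner \<Rightarrow> 'c::complex_inner"
  assumes F: "\<And>x y. F (x + y) = F x + F y" "\<And>c x. F (c *\<^sub>C x) = c *\<^sub>C F x" "rank_less F n"
    and V: "finite V" "n \<le> card V"
  shows "\<exists>c. (\<exists>v\<in>V. c v \<noteq> 0) \<and> F (\<Sum>v\<in>V. c v *\<^sub>C z v) = 0"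
proof -
  have "F 0 = 0"
    using F(1)[of 0 0] by simp
  have F_sum: "F (\<Sum>v\<in>V. c v *\<^sub>C z v) = (\<Sum>v\<in>V. c v *\<^sub>C F (z v))" for c
    using V(1) by (induction V rule: finite_induct) (simp_all add: F \<open>F 0 = 0\<close>)
  define g where "g v = F (z v)" for v
  show ?thesis
  \<comment> \<open>Dependence is a notion for sets, in which coinciding images would merge; such a
    pair gives a relation with coefficients 1 and -1 directly.\<close>
  proof (cases "inj_on g V")
    case False
    then obtain v w where vw: "v \<in> V" "w \<in> V" "v \<noteq> w" "g v = g w"
      by (auto simp: inj_on_def)
    define c where "c u = (if u = v then 1 else if u = w then - 1 else 0 :: complex)" for u
    have "(\<Sum>u\<in>V. c u *\<^sub>C g u) = (\<Sum>u\<in>{v, w}. c u *\<^sub>C g u)"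
      using vw V(1) by (intro sum.mono_neutral_right) (auto simp: c_def)
    also have "\<dots> = 0"
      using vw(3,4) by (simp add: c_def scaleC_one)
    finally show ?thesis
      using vw(1) by (intro exI[of _ c]) (auto simp: F_sum c_def g_def)
  next
    case True
    obtain S where S: "finite S" "range F \<subseteq> cspan S" and dim: "cdim (range F) < n"
      using F(3) by (auto simp: rank_less_def)
    obtain B where B: "B \<subseteq> range F" "complex_vector.independent B" "range F \<subseteq> cspan B"
      "card B = cdim (range F)"
      using complex_vector.basis_exists by blast
    \<comment> \<open>The finite spanning set in \<open>rank_less\<close> enters here:
      \<open>cdim\<close> is 0 in infinite dimension, so its bound alone says nothing.\<close>
    have "finite B"
      using complex_vector.independent_span_bound[OF S(1) B(2)] B(1) S(2) by blast
    have "\<not> complex_vector.independent (g ` V)"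
    proof
      assume "complex_vector.independent (g ` V)"
      moreover have "g ` V \<subseteq> cspan B"
        using B(3) by (auto simp: g_def)
      ultimately have "card (g ` V) \<le> card B"
        using complex_vector.independent_span_bound[OF \<open>finite B\<close>] by blast
      then show False
        using card_image[OF True] B(4) dim V(2) by simp
    qed
    then obtain u where u: "\<exists>w\<in>g ` V. u w \<noteq> 0" "(\<Sum>w\<in>g ` V. u w *\<^sub>C w) = 0"
      using complex_vector.dependent_finite[of "g ` V"] V(1) by blast
    then have "(\<Sum>v\<in>V. u (g v) *\<^sub>C F (z v)) = 0"
      using sum.reindex[OF True, of "\<lambda>w. u w *\<^sub>C w"] by (simp add: g_def)
    then show ?thesis
      using u(1) by (intro exI[of _ "\<lambda>v. u (g v)"]) (auto simp: F_sum)
  qed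
qed

text \<open>The hypothesis on \<open>T\<close> says that the off-diagonal operator with corners \<open>X\<close> and \<open>X\<^sup>*\<close> is
  dominated by \<open>T\<close>. On the span of the pairs \<open>(e, X e / l)\<close>, where \<open>e\<close> is an eigenvector of \<open>|X|\<close>
  for an eigenvalue \<open>l > t\<close>, this operator is at least \<open>t\<close>.\<close>

lemma ex_large_quadratic_form:
  fixes X :: "'a::chilbert_space \<Rightarrow> 'a" and T :: "'a \<times> 'a \<Rightarrow> 'a \<times> 'a"
    and F :: "'a \<times> 'a \<Rightarrow> 'c::complex_inner"
  assumes X: "bounded_clinear X" "seq_compact_op X"
    and T: "\<And>y x. 2 * (X y \<bullet> x) \<le> T (y, x) \<bullet> (y, x)"
    and t: "0 < t" "eigenbasis_above (op_abs X) t E" "n \<le> card E"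
    and F: "\<And>x y. F (x + y) = F x + F y" "\<And>c x. F (c *\<^sub>C x) = c *\<^sub>C F x" "rank_less F n"
  shows "\<exists>w. w \<noteq> 0 \<and> F w = 0 \<and> t * (norm w)\<^sup>2 \<le> T w \<bullet> w"
proof -
  note lin = bounded_clinearD[OF X(1)]
  have fin: "finite E" and on: "corthonormal (\<lambda>e. e) E"
    using t(2) by (auto simp: eigenbasis_above_def)
  obtain l f where l: "\<And>e. e \<in> E \<Longrightarrow> t < l e"
    and f: "corthonormal f E" "\<And>e. e \<in> E \<Longrightarrow> X e = l e *\<^sub>R f e"
    using eigenbasis_above_singular_vectors[OF X t(1,2)] by metis
  obtain c where c: "\<exists>e\<in>E. c e \<noteq> 0" and Fc: "F (\<Sum>e\<in>E. c e *\<^sub>C (e, f e)) = 0"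
    using ex_combination_in_kernel[OF F fin t(3), of "\<lambda>e. (e, f e)"] by blast
  define y x where "y = (\<Sum>e\<in>E. c e *\<^sub>C e)" and "x = (\<Sum>e\<in>E. c e *\<^sub>C f e)"
  define N where "N = (\<Sum>e\<in>E. (cmod (c e))\<^sup>2)"
  have yx: "(\<Sum>e\<in>E. c e *\<^sub>C (e, f e)) = (y, x)"
    by (simp add: y_def x_def scaleC_prod_def sum_prod)
  have "N > 0"
    unfolding N_def using c fin by (auto intro!: sum_pos2)
  \<comment> \<open>Both families are orthonormal, so each component contributes N. The 2 cancels
    the one in the domination hypothesis.\<close>
  have norm: "(norm (y, x))\<^sup>2 = 2 * N"
    using norm_sum_corthonormal[OF fin on, of c] norm_sum_corthonormal[OF fin f(1), of c]
    by (simp add: norm_Pair y_def x_def N_def sum_nonneg)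
  have "X y = (\<Sum>e\<in>E. (c e * l e) *\<^sub>C f e)"
    unfolding y_def lin using f(2)
    by (intro sum.cong) (auto simp: lin scaleC_scaleC simp flip: scaleC_of_real)
  then have "cinner (X y) x = (\<Sum>e\<in>E. (c e * l e) * cnj (c e))"
    by (simp add: x_def cinner_sum_sum_corthonormal[OF fin f(1)])
  also have "\<dots> = of_real (\<Sum>e\<in>E. l e * (cmod (c e))\<^sup>2)"
    unfolding of_real_sum of_real_mult complex_norm_square by (simp add: mult_ac)
  finally have "X y \<bullet> x = (\<Sum>e\<in>E. l e * (cmod (c e))\<^sup>2)"
    by (simp flip: Re_cinner)
  also have "\<dots> \<ge> t * N"
    unfolding N_def sum_distrib_left using l
    by (intro sum_mono mult_right_mono) (auto intro: less_imp_le)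
  finally have "t * (norm (y, x))\<^sup>2 \<le> T (y, x) \<bullet> (y, x)"
    using T[of y x] by (simp add: norm)
  moreover have "(y, x) \<noteq> 0"
    using norm \<open>N > 0\<close> by (metis norm_zero power_zero_numeral less_irrefl mult_pos_pos zero_less_numeral)
  ultimately show ?thesis
    using Fc yx by metis
qed

lemma rank_less_projection:
  fixes E :: "'b::complex_inner set"
  assumes "finite E" "card E < n"
  shows "rank_less (\<lambda>w. \<Sum>e\<in>E. cinner w e *\<^sub>C e) n"
proof -
  have sub: "range (\<lambda>w. \<Sum>e\<in>E. cinner w e *\<^sub>C e) \<subseteq> cspan E"
    by (auto intro: complex_vector.span_sum complex_vector.span_scale complex_vector.span_base)
  have "cdim (range (\<lambda>w. \<Sum>e\<in>E. cinner w e *\<^sub>C e)) \<le> card E"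
    by (rule complex_vector.dim_le_card[OF sub assms(1)])
  then show ?thesis
    using sub assms unfolding rank_less_def by fastforce
qed

text \<open>If the inequality failed, some F of rank less than j would satisfy |T w| <= r |w| on its
  kernel with r below s_j(X). \<open>ex_large_quadratic_form\<close> puts into that kernel a nonzero
  w whose form is at least t |w|^2 with t > r, against Cauchy-Schwarz. How F is found depends on the
  branch of \<open>singular_value\<close> that applies to T.\<close>

lemma singular_value_le_dominating:
  fixes X :: "'a::chilbert_space \<Rightarrow> 'a" and T :: "'a \<times> 'a \<Rightarrow> 'a \<times> 'a"
  assumes X: "compact_op X" and T: "bounded_clinear T"
    and dom: "\<And>y x. 2 * (X y \<bullet> x) \<le> T (y, x) \<bullet> (y, x)" and "1 \<le> j"
  shows "singular_value j X \<le> singular_value j T"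
proof (rule ccontr)
  assume "\<not> singular_value j X \<le> singular_value j T"
  then have less: "singular_value j T < singular_value j X"
    by simp
  have X': "bounded_clinear X" "seq_compact_op X"
    using X compact_op_imp_seq_compact_op by (auto simp: compact_op_def)
  note R = op_abs_props[OF X']
  have large: "\<exists>w. w \<noteq> 0 \<and> F w = 0 \<and> t * (norm w)\<^sup>2 \<le> T w \<bullet> w"
    if t: "0 < t" "t < singular_value j X"
      and F: "\<And>x y. F (x + y) = F x + F y" "\<And>c x. F (c *\<^sub>C x) = c *\<^sub>C F x" "rank_less F j"
    for t and F :: "'a \<times> 'a \<Rightarrow> 'a \<times> 'a"
  proof -
    obtain E where E: "eigenbasis_above (op_abs X) t E"
      using ex_eigenbasis_above[OF R(1) t(1)] by blast
    have "t < eigenvalue_seq (op_abs X) (j - 1)"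
      using t(2) X by (simp add: singular_value_def)
    then have "j - 1 < card E"
      using eigenvalue_seq_props(2)[OF R(1) t(1) E] by blast
    then have "j \<le> card E"
      using \<open>1 \<le> j\<close> by linarith
    from ex_large_quadratic_form[OF X' dom t(1) E this F] show ?thesis .
  qed
  have small: False if "w \<noteq> 0" "t * (norm w)\<^sup>2 \<le> T w \<bullet> w" "norm (T w) \<le> r * norm w" "r < t" for w t r
  proof -
    have "T w \<bullet> w \<le> norm (T w) * norm w"
      by (rule norm_cauchy_schwarz)
    also have "\<dots> \<le> r * norm w * norm w"
      using that(3) by (rule mult_right_mono) simp
    also have "\<dots> < t * (norm w)\<^sup>2"
      using that(1,4) by (simp add: power2_eq_square)
    finally show False
      using that(2) by simp
  qed
  show False
  proof (cases "compact_op T")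
    case True
    note R' = op_abs_props[OF T compact_op_imp_seq_compact_op[OF True]]
    \<comment> \<open>Two strict thresholds: r exceeds s_j(T) and so is positive even if that value
      is 0, and t > r leaves the gap for the contradiction.\<close>
    obtain r where r: "singular_value j T < r" "r < singular_value j X"
      using dense[OF less] by blast
    obtain t where t: "r < t" "t < singular_value j X"
      using dense[OF r(2)] by blast
    have "0 \<le> singular_value j T" and r': "\<not> r < eigenvalue_seq (op_abs T) (j - 1)"
      using eigenvalue_seq_props(1)[OF R'(1)] True r by (auto simp: singular_value_def)
    then have "0 < r"
      using r(1) by simp
    then obtain E where E: "eigenbasis_above (op_abs T) r E"
      using ex_eigenbasis_above[OF R'(1)] by blast
    then have fin: "finite E" and on: "corthonormal (\<lambda>e. e) E"
      by (auto simp: eigenbasis_above_def)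
    \<comment> \<open>The sequence starts at index 0, so an entry j - 1 not above r leaves at most j
      - 1 eigenvectors; \<open>F\<close> is the projection onto their span.\<close>
    have "card E < j"
      using eigenvalue_seq_props(2)[OF R'(1) \<open>0 < r\<close> E, of "j - 1"] r' \<open>1 \<le> j\<close> by linarith
    define F where "F w = (\<Sum>e\<in>E. cinner w e *\<^sub>C e)" for w
    have "F (x + y) = F x + F y" for x y
      by (simp add: F_def cinner_add_left scaleC_add_left sum.distrib)
    moreover have "F (c *\<^sub>C x) = c *\<^sub>C F x" for c x
      by (simp add: F_def cinner_scaleC_left complex_vector.scale_sum_right scaleC_scaleC)
    moreover have "rank_less F j"
      using rank_less_projection[OF fin \<open>card E < j\<close>] by (simp add: F_def[abs_def])
    ultimately obtain w where w: "w \<noteq> 0" "F w = 0" "t * (norm w)\<^sup>2 \<le> T w \<bullet> w"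
      using large[of t F] t \<open>0 < r\<close> by auto
    have "cinner w e = 0" if "e \<in> E" for e
      using cinner_sum_corthonormal[OF fin on that, of "cinner w"] w(2) by (simp add: F_def)
    then have "norm (op_abs T w) \<le> r * norm w"
      using E unfolding eigenbasis_above_def by blast
    then show False
      using small[OF w(1,3), of r] t(1) by (simp add: R'(3))
  next
    \<comment> \<open>In the application this occurs for \<alpha> = 0 or 1 in infinite dimensions,
      where one block is twice the identity. \<open>F\<close> is then a near-optimal
      approximant.\<close>
    case False
    define S where "S = {onorm (\<lambda>x. T x - F x) | F. bounded_clinear F \<and> rank_less F j}"
    have sv: "singular_value j T = Inf S"
      using False by (simp add: singular_value_def S_def)
    \<comment> \<open>Since j is at least 1 the zero operator is admissible, so the infimum is over
      a nonempty set.\<close>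
    have "bounded_clinear (\<lambda>_. 0 :: 'a \<times> 'a)"
      by (simp add: bounded_clinear_def bounded_linear_zero)
    moreover have "rank_less (\<lambda>_ :: 'a \<times> 'a. 0 :: 'a \<times> 'a) j"
      using rank_less_projection[of "{} :: ('a \<times> 'a) set" j] \<open>1 \<le> j\<close> by simp
    ultimately have "S \<noteq> {}"
      unfolding S_def by blast
    then obtain F where F: "bounded_clinear F" "rank_less F j"
      and onorm_less: "onorm (\<lambda>x. T x - F x) < singular_value j X"
      using cInf_lessD[of S "singular_value j X"] less sv unfolding S_def by force
    have bl: "bounded_linear (\<lambda>x. T x - F x)"
      by (intro bounded_linear_sub bounded_clinearD(1) T F(1))
    obtain t where t: "onorm (\<lambda>x. T x - F x) < t" "t < singular_value j X"
      using dense[OF onorm_less] by blast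
    have "0 < t"
      using onorm_pos_le[OF bl] t(1) by linarith
    then obtain w where w: "w \<noteq> 0" "F w = 0" "t * (norm w)\<^sup>2 \<le> T w \<bullet> w"
      using large[OF _ t(2) bounded_clinearD(3)[OF F(1)] bounded_clinearD(2)[OF F(1)] F(2)] by blast
    have "norm (T w) \<le> onorm (\<lambda>x. T x - F x) * norm w"
      using onorm[OF bl, of w] w(2) by simp
    then show False
      using small[OF w(1,3)] t(1) by blast
  qed
qed

lemma bounded_clinear_map_prod:
  assumes "bounded_clinear S" "bounded_clinear T"
  shows "bounded_clinear (map_prod S T)"
proof -
  have "bounded_linear (\<lambda>p. (S (fst p), T (snd p)))"
    using assms[THEN bounded_clinearD(1)]
    by (intro bounded_linear_Pair bounded_linear_compose[OF _ bounded_linear_fst]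
        bounded_linear_compose[OF _ bounded_linear_snd])
  then show ?thesis
    using assms by (simp add: bounded_clinear_def map_prod_def case_prod_beta' scaleC_prod_def)
qed

theorem theorem2p3:
  fixes A B :: "'a::chilbert_space \<Rightarrow> 'a" and \<alpha> :: real and j :: nat
  assumes "separable_space (euclidean :: 'a topology)"
    and "compact_op A" and "compact_op B"
    and "0 \<le> \<alpha>" and "\<alpha> \<le> 1"
    and "1 \<le> j"
  shows "singular_value j (\<lambda>x. A x + B x)
    \<le> singular_value j
        (op_dsum (\<lambda>x. op_powr (op_abs A) (2 * \<alpha>) x + op_powr (op_abs B) (2 * \<alpha>) x)
                 (\<lambda>x. op_powr (op_abs (cadjoint A)) (2 * (1 - \<alpha>)) x
                    + op_powr (op_abs (cadjoint B)) (2 * (1 - \<alpha>)) x))"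
proof (rule singular_value_le_dominating)
  show "compact_op (\<lambda>x. A x + B x)" and "1 \<le> j"
    using assms compact_op_add by blast+
  have A: "bounded_clinear A" "seq_compact_op A" and B: "bounded_clinear B" "seq_compact_op B"
    using assms compact_op_imp_seq_compact_op by (auto simp: compact_op_def)
  have "bounded_clinear (op_powr (op_abs T) r)" "bounded_clinear (op_powr (op_abs (cadjoint T)) r)"
    if "bounded_clinear T" "seq_compact_op T" "0 \<le> r" for T :: "'a \<Rightarrow> 'a" and r
    using that by (auto intro!: op_powr_props(1) op_abs_props(1) bounded_clinear_cadjoint
        seq_compact_op_cadjoint)
  then show "bounded_clinear
        (op_dsum (\<lambda>x. op_powr (op_abs A) (2 * \<alpha>) x + op_powr (op_abs B) (2 * \<alpha>) x)
                 (\<lambda>x. op_powr (op_abs (cadjoint A)) (2 * (1 - \<alpha>)) x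
                    + op_powr (op_abs (cadjoint B)) (2 * (1 - \<alpha>)) x))"
    using A B assms(4,5) by (intro bounded_clinear_map_prod bounded_clinear_add) auto
  show "2 * ((A y + B y) \<bullet> x)
      \<le> op_dsum (\<lambda>x. op_powr (op_abs A) (2 * \<alpha>) x + op_powr (op_abs B) (2 * \<alpha>) x)
          (\<lambda>x. op_powr (op_abs (cadjoint A)) (2 * (1 - \<alpha>)) x
            + op_powr (op_abs (cadjoint B)) (2 * (1 - \<alpha>)) x) (y, x) \<bullet> (y, x)" for y x
    using mixed_Schwarz[OF A assms(4,5), of y x] mixed_Schwarz[OF B assms(4,5), of y x]
    by (simp add: inner_add_left)
qed

end
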